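(* Let $(E_1,\|\cdot\|)$ and $(E_2,\|\cdot\|)$ be two $RN$ modules over $\mathbb K$ with base $(\Omega,\mathcal F,P)$, and let $G_1\subset E_1$ and $G_2\subset E_2$ be two $\sigma$-stable subsets. Then a $\sigma$-stable mapping $T$ of $G_1$ to $G_2$ is random sequentially continuous if and only if it is $\mathcal T_c$-continuous. In particular, if a $\sigma$-stable mapping $T$ of $G_1$ to $G_2$ is $\mathcal T_{\varepsilon,\lambda}$-continuous, then $T$ must be $\mathcal T_c$-continuous.
   Context: Notation. $(\Omega,\mathcal F,P)$ is a probability space, $\mathbb K$ is $\mathbb R$ or $\mathbb C$. $L^0(\mathcal F,\mathbb K)$ is the algebra of a.s.-equivalence classes of $\mathbb K$-valued $\mathcal F$-measurable random variables; $L^0(\mathcal F)=L^0(\mathcal F,\mathbb R)$, partially ordered by $\xi\le\eta$ iff $\xi(\omega)\le\eta(\omega)$ a.s.; "$\xi<\eta$ on $\Omega$" means $\xi(\omega)<\eta(\omega)$ a.s. $L^0_+(\mathcal F)=\{\xi\in L^0(\mathcal F):\xi\ge 0\}$, $L^0_{++}(\mathcal F)=\{\xi\in L^0(\mathcal F):\xi>0\text{ on }\Omega\}$. $\tilde I_A$ is the equivalence class of the indicator function $I_A$ of $A\in\mathcal F$. $RN$ module. An $RN$ module $(E,\|\cdot\|)$ over $\mathbb K$ with base $(\Omega,\mathcal F,P)$ is a left module $E$ over the algebra $L^0(\mathcal F,\mathbb K)$ with a map $\|\cdot\|:E\to L^0_+(\mathcal F)$ such that $\|\xi x\|=|\xi|\,\|x\|$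 for all $\xi\in L^0(\mathcal F,\mathbb K)$, $x\in E$; $\|x+y\|\le\|x\|+\|y\|$ for all $x,y\in E$; and $\|x\|=0$ implies $x=\theta$ (the null element). Topologies. The $(\varepsilon,\lambda)$-topology $\mathcal T_{\varepsilon,\lambda}$ on $E$ is the metrizable linear topology with local base at $\theta$ given by the sets $\{x\in E: P\{\omega:\|x\|(\omega)<\varepsilon\}>1-\lambda\}$, $\varepsilon>0$, $0<\lambda<1$; so $x_n\to x$ in $\mathcal T_{\varepsilon,\lambda}$ iff $\|x_n-x\|\to 0$ in probability. The locally $L^0$-convex topology $\mathcal T_c$ on $E$ is the Hausdorff (translation invariant) topology with local base at $\theta$ given by the sets $\{x\in E:\|x\|<\varepsilon\text{ on }\Omega\}$, $\varepsilon\in L^0_{++}(\mathcal F)$. $\mathcal T_{\varepsilon,\lambda}$- (resp. $\mathcal T_c$-) continuity of $T:G_1\to G_2$ means continuity for the relative topologies induced by $\mathcal T_{\varepsilon,\lambda}$ (resp. $\mathcal T_c$) on $G_1$ and $G_2$. $\sigma$-stability. A countable partition of $\Omega$ to $\mathcal F$ is a sequence $\{A_n,n\in\mathbb N\}$ of pairwise disjoint members of $\mathcal F$ with union $\Omega$. A nonempty $G\subset E$ is $\sigma$-stable if for every sequence $\{x_n\}$ in $G$ and every countable partition $\{A_n\}$ of $\Omega$ to $\mathcal F$ there is $x\in G$ with $\tilde I_{A_n}x=\tilde I_{A_n}x_n$ for all $n$; such $x$ is unique and is written $\sum_n\tilde I_{A_n}x_n$. For $\sigma$-stable $G_1,G_2$,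 $T:G_1\to G_2$ is $\sigma$-stable if $T(\sum_k\tilde I_{A_k}x_k)=\sum_k\tilde I_{A_k}T(x_k)$ for every countable partition $\{A_k\}$ of $\Omega$ to $\mathcal F$ and every sequence $\{x_k\}$ in $G_1$. Random sequential continuity. A random subsequence of a sequence $\{x_n\}$ in the $\sigma$-stable set $G_1$ is a sequence $\{x_{n_k},k\in\mathbb N\}$, $x_{n_k}:=\sum_{l=1}^\infty\tilde I_{(n_k=l)}x_l$, where the $n_k$ are positive-integer-valued random variables on $(\Omega,\mathcal F,P)$ with $n_k(\omega)<n_{k+1}(\omega)$ for all $k\in\mathbb N$, $\omega\in\Omega$. $T$ is random sequentially continuous if for every $x_0\in G_1$ and every sequence $\{x_n\}$ in $G_1$ converging in $\mathcal T_{\varepsilon,\lambda}$ to $x_0$ there is a random subsequence $\{x_{n_k}\}$ of $\{x_n\}$ such that $\{T(x_{n_k})\}$ converges in $\mathcal T_{\varepsilon,\lambda}$ to $T(x_0)$. *)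

theory Defs
  imports "HOL-Probability.Probability" "HOL-Algebra.Module"
begin

section \<open>The algebra of equivalence classes of random variables\<close>

text \<open>
  The scalar field is a type of class real_normed_field and euclidean_space. Both \<^typ>\<open>real\<close> and
  \<^typ>\<open>complex\<close> belong to this sort and, by the theorem of Gelfand and Mazur, every type of this
  sort is isomorphic, as a normed field, to one of them.
\<close>

type_synonym ('w, 'k) rv_class = "('w \<Rightarrow> 'k) set"

definition ae_rel :: "'w measure \<Rightarrow> (('w \<Rightarrow> 'k::{real_normed_field,euclidean_space}) \<times> ('w \<Rightarrow> 'k)) set"
  where "ae_rel M =
    {(f, g). f \<in> borel_measurable M \<and> g \<in> borel_measurable M \<and> (AE \<omega> in M. f \<omega> = g \<omega>)}"

definition ae_class :: "'w measure \<Rightarrow> ('w \<Rightarrow> 'k::{real_normed_field,euclidean_space}) \<Rightarrow> ('w, 'k) rv_class"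
  where "ae_class M f = ae_rel M `` {f}"

text \<open>
  An arbitrarily chosen representative. All notions below that are defined through \<open>rep\<close> are
  unaffected by the choice, since two representatives agree almost surely.
\<close>

definition rep :: "('w, 'k) rv_class \<Rightarrow> 'w \<Rightarrow> 'k"
  where "rep \<xi> = (SOME f. f \<in> \<xi>)"

definition L0 :: "'w measure \<Rightarrow> ('w, 'k::{real_normed_field,euclidean_space}) rv_class ring"
  where "L0 M =
    \<lparr>carrier = borel_measurable M // ae_rel M,
     mult = (\<lambda>\<xi> \<eta>. ae_class M (\<lambda>\<omega>. rep \<xi> \<omega> * rep \<eta> \<omega>)),
     one = ae_class M (\<lambda>\<omega>. 1),
     zero = ae_class M (\<lambda>\<omega>. 0),
     add = (\<lambda>\<xi> \<eta>. ae_class M (\<lambda>\<omega>. rep \<xi> \<omega> + rep \<eta> \<omega>))\<rparr>"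

definition L0_abs :: "'w measure \<Rightarrow> ('w, 'k::{real_normed_field,euclidean_space}) rv_class \<Rightarrow> ('w, real) rv_class"
  where "L0_abs M \<xi> = ae_class M (\<lambda>\<omega>. norm (rep \<xi> \<omega>))"

definition L0_ind :: "'w measure \<Rightarrow> 'w set \<Rightarrow> ('w, 'k::{real_normed_field,euclidean_space}) rv_class"
  where "L0_ind M A = ae_class M (indicator A)"

definition L0_le :: "'w measure \<Rightarrow> ('w, real) rv_class \<Rightarrow> ('w, real) rv_class \<Rightarrow> bool"
  where "L0_le M \<xi> \<eta> \<longleftrightarrow> (AE \<omega> in M. rep \<xi> \<omega> \<le> rep \<eta> \<omega>)"

text \<open>Strict inequality almost surely, which is more than \<open>\<xi> \<le> \<eta>\<close> and \<open>\<xi> \<noteq> \<eta>\<close>.\<close>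

definition L0_less :: "'w measure \<Rightarrow> ('w, real) rv_class \<Rightarrow> ('w, real) rv_class \<Rightarrow> bool"
  where "L0_less M \<xi> \<eta> \<longleftrightarrow> (AE \<omega> in M. rep \<xi> \<omega> < rep \<eta> \<omega>)"

definition L0_nonneg :: "'w measure \<Rightarrow> ('w, real) rv_class set"
  where "L0_nonneg M = {\<xi> \<in> carrier (L0 M). L0_le M \<zero>\<^bsub>L0 M\<^esub> \<xi>}"

definition L0_pos :: "'w measure \<Rightarrow> ('w, real) rv_class set"
  where "L0_pos M = {\<xi> \<in> carrier (L0 M). L0_less M \<zero>\<^bsub>L0 M\<^esub> \<xi>}"

lemma ae_class_eq_iff:
  assumes "f \<in> borel_measurable M" "g \<in> borel_measurable M"
  shows "ae_class M f = ae_class M g \<longleftrightarrow> (AE \<omega> in M. f \<omega> = g \<omega>)"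
proof
  assume "ae_class M f = ae_class M g"
  moreover have "g \<in> ae_class M g" using assms by (simp add: ae_class_def ae_rel_def)
  ultimately have "g \<in> ae_class M f" by simp
  then show "AE \<omega> in M. f \<omega> = g \<omega>" by (simp add: ae_class_def ae_rel_def)
next
  assume *: "AE \<omega> in M. f \<omega> = g \<omega>"
  have "(AE \<omega> in M. f \<omega> = h \<omega>) \<longleftrightarrow> (AE \<omega> in M. g \<omega> = h \<omega>)" for h
  proof
    assume "AE \<omega> in M. f \<omega> = h \<omega>"
    with * show "AE \<omega> in M. g \<omega> = h \<omega>" by eventually_elim simp
  next
    assume "AE \<omega> in M. g \<omega> = h \<omega>"
    with * show "AE \<omega> in M. f \<omega> = h \<omega>" by eventually_elim simp
  qed
  then show "ae_class M f = ae_class M g"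
    using assms by (auto simp: ae_class_def ae_rel_def)
qed

lemma ae_class_in_L0: "f \<in> borel_measurable M \<Longrightarrow> ae_class M f \<in> carrier (L0 M)"
  by (auto simp: L0_def ae_class_def intro: quotientI)

lemma rep_ae_class:
  assumes "f \<in> borel_measurable M"
  shows "rep (ae_class M f) \<in> borel_measurable M" "AE \<omega> in M. rep (ae_class M f) \<omega> = f \<omega>"
proof -
  have "f \<in> ae_class M f" using assms by (simp add: ae_class_def ae_rel_def)
  then have "rep (ae_class M f) \<in> ae_class M f" unfolding rep_def by (rule someI[of "\<lambda>g. g \<in> ae_class M f"])
  then have *: "rep (ae_class M f) \<in> borel_measurable M" "AE \<omega> in M. f \<omega> = rep (ae_class M f) \<omega>"
    by (auto simp: ae_class_def ae_rel_def)
  show "rep (ae_class M f) \<in> borel_measurable M" by (rule *)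
  show "AE \<omega> in M. rep (ae_class M f) \<omega> = f \<omega>" using *(2) by eventually_elim simp
qed

lemma L0_cases:
  assumes "\<xi> \<in> carrier (L0 M)"
  obtains f where "f \<in> borel_measurable M" "\<xi> = ae_class M f"
  using assms by (auto simp: L0_def ae_class_def elim!: quotientE)

lemma L0_ops:
  assumes "f \<in> borel_measurable M" "g \<in> borel_measurable M"
  shows "ae_class M f \<oplus>\<^bsub>L0 M\<^esub> ae_class M g = ae_class M (\<lambda>\<omega>. f \<omega> + g \<omega>)"
    and "ae_class M f \<otimes>\<^bsub>L0 M\<^esub> ae_class M g = ae_class M (\<lambda>\<omega>. f \<omega> * g \<omega>)"
proof -
  note [measurable] = assms rep_ae_class(1)[OF assms(1)] rep_ae_class(1)[OF assms(2)]
  note ae = rep_ae_class(2)[OF assms(1)] rep_ae_class(2)[OF assms(2)]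
  have "AE \<omega> in M. rep (ae_class M f) \<omega> + rep (ae_class M g) \<omega> = f \<omega> + g \<omega>"
    using ae by eventually_elim simp
  then show "ae_class M f \<oplus>\<^bsub>L0 M\<^esub> ae_class M g = ae_class M (\<lambda>\<omega>. f \<omega> + g \<omega>)"
    by (simp add: L0_def) (subst ae_class_eq_iff; measurable)
  have "AE \<omega> in M. rep (ae_class M f) \<omega> * rep (ae_class M g) \<omega> = f \<omega> * g \<omega>"
    using ae by eventually_elim simp
  then show "ae_class M f \<otimes>\<^bsub>L0 M\<^esub> ae_class M g = ae_class M (\<lambda>\<omega>. f \<omega> * g \<omega>)"
    by (simp add: L0_def) (subst ae_class_eq_iff; measurable)
qed

lemma L0_zero_one: "\<zero>\<^bsub>L0 M\<^esub> = ae_class M (\<lambda>\<omega>. 0)" "\<one>\<^bsub>L0 M\<^esub> = ae_class M (\<lambda>\<omega>. 1)"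
  by (simp_all add: L0_def)

lemma cring_L0: "cring (L0 M :: ('w, 'k::{real_normed_field,euclidean_space}) rv_class ring)"
proof (rule cringI)
  show "abelian_group (L0 M :: ('w, 'k) rv_class ring)"
  proof (rule abelian_groupI)
    fix x :: "('w, 'k) rv_class" assume "x \<in> carrier (L0 M)"
    then obtain f where f [measurable]: "f \<in> borel_measurable M" and x: "x = ae_class M f"
      by (rule L0_cases)
    show "\<exists>y\<in>carrier (L0 M). y \<oplus>\<^bsub>L0 M\<^esub> x = \<zero>\<^bsub>L0 M\<^esub>"
      by (rule bexI[of _ "ae_class M (\<lambda>\<omega>. - f \<omega>)"])
        (simp_all add: x L0_ops L0_zero_one ae_class_in_L0)
  qed (auto elim!: L0_cases simp: L0_ops L0_zero_one ae_class_in_L0 add_ac)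
  show "comm_monoid (L0 M :: ('w, 'k) rv_class ring)"
    by (rule comm_monoidI)
      (auto elim!: L0_cases simp: L0_ops L0_zero_one ae_class_in_L0 mult_ac)
qed (auto elim!: L0_cases simp: L0_ops ae_class_in_L0 algebra_simps)

section \<open>Random normed modules and their topologies\<close>

locale rn_module = prob_space M + E: Module.module "L0 M" E
  for M :: "'w measure"
    and E :: "(('w, 'k::{real_normed_field,euclidean_space}) rv_class, 'e) module" +
  fixes nrm :: "'e \<Rightarrow> ('w, real) rv_class"
  assumes nrm_nonneg: "x \<in> carrier E \<Longrightarrow> nrm x \<in> L0_nonneg M"
    and nrm_smult: "\<lbrakk>\<xi> \<in> carrier (L0 M); x \<in> carrier E\<rbrakk> \<Longrightarrow>
      nrm (\<xi> \<odot>\<^bsub>E\<^esub> x) = L0_abs M \<xi> \<otimes>\<^bsub>L0 M\<^esub> nrm x"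
    and nrm_triangle: "\<lbrakk>x \<in> carrier E; y \<in> carrier E\<rbrakk> \<Longrightarrow>
      L0_le M (nrm (x \<oplus>\<^bsub>E\<^esub> y)) (nrm x \<oplus>\<^bsub>L0 M\<^esub> nrm y)"
    and nrm_eq_zero: "\<lbrakk>x \<in> carrier E; nrm x = \<zero>\<^bsub>L0 M\<^esub>\<rbrakk> \<Longrightarrow> x = \<zero>\<^bsub>E\<^esub>"

text \<open>
  The translation invariant topology with local base \<open>\<B>\<close> at the null element. The predicate below is a
  topology as soon as \<open>\<B>\<close> is a filter base (\<open>openin_ti_topology\<close>), which holds for both families of
  neighbourhoods used here (\<open>openin_el_topology\<close> and \<open>openin_c_topology\<close>).
\<close>

definition ti_topology :: "('a, 'e) module \<Rightarrow> 'e set set \<Rightarrow> 'e topology"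
  where "ti_topology E \<B> =
    topology (\<lambda>U. U \<subseteq> carrier E \<and> (\<forall>x\<in>U. \<exists>N\<in>\<B>. (\<oplus>\<^bsub>E\<^esub>) x ` N \<subseteq> U))"

text \<open>The parameter \<open>\<delta>\<close> is the \<open>\<lambda>\<close> of the \<open>(\<epsilon>,\<lambda>)\<close>-topology.\<close>

definition el_nbhd :: "'w measure \<Rightarrow> ('a, 'e) module \<Rightarrow> ('e \<Rightarrow> ('w, real) rv_class) \<Rightarrow> real \<Rightarrow> real \<Rightarrow> 'e set"
  where "el_nbhd M E nrm \<epsilon> \<delta> =
    {x \<in> carrier E. measure M {\<omega> \<in> space M. rep (nrm x) \<omega> < \<epsilon>} > 1 - \<delta>}"

definition el_topology :: "'w measure \<Rightarrow> ('a, 'e) module \<Rightarrow> ('e \<Rightarrow> ('w, real) rv_class) \<Rightarrow> 'e topology"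
  where "el_topology M E nrm =
    ti_topology E {el_nbhd M E nrm \<epsilon> \<delta> | \<epsilon> \<delta>. 0 < \<epsilon> \<and> 0 < \<delta> \<and> \<delta> < 1}"

definition c_nbhd :: "'w measure \<Rightarrow> ('a, 'e) module \<Rightarrow> ('e \<Rightarrow> ('w, real) rv_class) \<Rightarrow> ('w, real) rv_class \<Rightarrow> 'e set"
  where "c_nbhd M E nrm \<epsilon> = {x \<in> carrier E. L0_less M (nrm x) \<epsilon>}"

definition c_topology :: "'w measure \<Rightarrow> ('a, 'e) module \<Rightarrow> ('e \<Rightarrow> ('w, real) rv_class) \<Rightarrow> 'e topology"
  where "c_topology M E nrm = ti_topology E {c_nbhd M E nrm \<epsilon> | \<epsilon>. \<epsilon> \<in> L0_pos M}"

lemma openin_ti_topology: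
  assumes "\<B> \<noteq> {}" and "\<And>N N'. \<lbrakk>N \<in> \<B>; N' \<in> \<B>\<rbrakk> \<Longrightarrow> \<exists>N''\<in>\<B>. N'' \<subseteq> N \<inter> N'"
  shows "openin (ti_topology E \<B>) U \<longleftrightarrow> U \<subseteq> carrier E \<and> (\<forall>x\<in>U. \<exists>N\<in>\<B>. (\<oplus>\<^bsub>E\<^esub>) x ` N \<subseteq> U)"
proof -
  let ?P = "\<lambda>U. U \<subseteq> carrier E \<and> (\<forall>x\<in>U. \<exists>N\<in>\<B>. (\<oplus>\<^bsub>E\<^esub>) x ` N \<subseteq> U)"
  have mono: "(\<oplus>\<^bsub>E\<^esub>) x ` N \<subseteq> (\<oplus>\<^bsub>E\<^esub>) x ` N'" if "N \<subseteq> N'" for x N N'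
    using that by auto
  have "istopology ?P"
    unfolding istopology_def
  proof (intro conjI allI impI)
    fix S T assume S: "?P S" and T: "?P T"
    show "S \<inter> T \<subseteq> carrier E" using S by auto
    show "\<forall>x\<in>S \<inter> T. \<exists>N\<in>\<B>. (\<oplus>\<^bsub>E\<^esub>) x ` N \<subseteq> S \<inter> T"
    proof
      fix x assume "x \<in> S \<inter> T"
      with S T obtain N N' where N: "N \<in> \<B>" "(\<oplus>\<^bsub>E\<^esub>) x ` N \<subseteq> S" "N' \<in> \<B>" "(\<oplus>\<^bsub>E\<^esub>) x ` N' \<subseteq> T"
        by (meson IntD1 IntD2)
      from assms(2)[OF N(1,3)] obtain N'' where "N'' \<in> \<B>" "N'' \<subseteq> N" "N'' \<subseteq> N'" by auto
      with N mono show "\<exists>N\<in>\<B>. (\<oplus>\<^bsub>E\<^esub>) x ` N \<subseteq> S \<inter> T" by (meson Int_greatest subset_trans)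
    qed
  next
    fix \<K> assume "\<forall>K\<in>\<K>. ?P K"
    then show "\<Union>\<K> \<subseteq> carrier E" "\<forall>x\<in>\<Union>\<K>. \<exists>N\<in>\<B>. (\<oplus>\<^bsub>E\<^esub>) x ` N \<subseteq> \<Union>\<K>"
      by (blast, meson Sup_upper UnionE subset_trans)
  qed
  then show ?thesis by (simp add: ti_topology_def topology_inverse')
qed

lemma (in rn_module) nrm_meas:
  assumes "x \<in> carrier E"
  shows "rep (nrm x) \<in> borel_measurable M"
proof -
  have "nrm x \<in> carrier (L0 M)" using nrm_nonneg[OF assms] by (simp add: L0_nonneg_def)
  then show ?thesis by (auto elim!: L0_cases intro: rep_ae_class)
qed

lemma (in rn_module) openin_el_topology:
  "openin (el_topology M E nrm) U \<longleftrightarrow> U \<subseteq> carrier E \<and>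
    (\<forall>x\<in>U. \<exists>\<epsilon> \<delta>. 0 < \<epsilon> \<and> 0 < \<delta> \<and> \<delta> < 1 \<and> (\<oplus>\<^bsub>E\<^esub>) x ` el_nbhd M E nrm \<epsilon> \<delta> \<subseteq> U)"
proof -
  let ?B = "{el_nbhd M E nrm \<epsilon> \<delta> | \<epsilon> \<delta>. 0 < \<epsilon> \<and> 0 < \<delta> \<and> \<delta> < 1}"
  have mono: "el_nbhd M E nrm \<epsilon> \<delta> \<subseteq> el_nbhd M E nrm \<epsilon>' \<delta>'" if "\<epsilon> \<le> \<epsilon>'" "\<delta> \<le> \<delta>'" for \<epsilon> \<delta> \<epsilon>' \<delta>'
  proof
    fix x assume x: "x \<in> el_nbhd M E nrm \<epsilon> \<delta>"
    then have [measurable]: "rep (nrm x) \<in> borel_measurable M"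
      by (auto simp: el_nbhd_def intro: nrm_meas)
    have "measure M {\<omega> \<in> space M. rep (nrm x) \<omega> < \<epsilon>} \<le> measure M {\<omega> \<in> space M. rep (nrm x) \<omega> < \<epsilon>'}"
      using that by (intro finite_measure_mono) auto
    with x that show "x \<in> el_nbhd M E nrm \<epsilon>' \<delta>'" by (auto simp: el_nbhd_def)
  qed
  have "el_nbhd M E nrm 1 (1/2) \<in> ?B"
    by (intro CollectI exI conjI refl) auto
  then have ne: "?B \<noteq> {}" by blast
  have int: "\<exists>N''\<in>?B. N'' \<subseteq> N \<inter> N'" if "N \<in> ?B" "N' \<in> ?B" for N N'
  proof -
    from that obtain \<epsilon> \<delta> \<epsilon>' \<delta>' where
      N: "N = el_nbhd M E nrm \<epsilon> \<delta>" "N' = el_nbhd M E nrm \<epsilon>' \<delta>'"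
      and pos: "0 < \<epsilon>" "0 < \<delta>" "\<delta> < 1" "0 < \<epsilon>'" "0 < \<delta>'" "\<delta>' < 1" by auto
    have "el_nbhd M E nrm (min \<epsilon> \<epsilon>') (min \<delta> \<delta>') \<subseteq> N \<inter> N'"
      unfolding N by (rule Int_greatest; rule mono; simp)
    moreover have "el_nbhd M E nrm (min \<epsilon> \<epsilon>') (min \<delta> \<delta>') \<in> ?B"
      by (rule CollectI, rule exI[of _ "min \<epsilon> \<epsilon>'"], rule exI[of _ "min \<delta> \<delta>'"]) (use pos in simp)
    ultimately show ?thesis by blast
  qed
  have "openin (el_topology M E nrm) U \<longleftrightarrow>
    U \<subseteq> carrier E \<and> (\<forall>x\<in>U. \<exists>N\<in>?B. (\<oplus>\<^bsub>E\<^esub>) x ` N \<subseteq> U)"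
    unfolding el_topology_def by (rule openin_ti_topology[OF ne]) (rule int)
  moreover have "(\<exists>N\<in>?B. Q N) \<longleftrightarrow>
    (\<exists>\<epsilon> \<delta>. 0 < \<epsilon> \<and> 0 < \<delta> \<and> \<delta> < 1 \<and> Q (el_nbhd M E nrm \<epsilon> \<delta>))" for Q by blast
  ultimately show ?thesis by (simp only:)
qed

lemma (in rn_module) openin_c_topology:
  "openin (c_topology M E nrm) U \<longleftrightarrow> U \<subseteq> carrier E \<and>
    (\<forall>x\<in>U. \<exists>\<epsilon>\<in>L0_pos M. (\<oplus>\<^bsub>E\<^esub>) x ` c_nbhd M E nrm \<epsilon> \<subseteq> U)"
proof -
  let ?B = "{c_nbhd M E nrm \<epsilon> | \<epsilon>. \<epsilon> \<in> L0_pos M}"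
  have pos_iff: "ae_class M f \<in> L0_pos M \<longleftrightarrow> (AE \<omega> in M. 0 < f \<omega>)"
    if f: "f \<in> borel_measurable M" for f :: "'w \<Rightarrow> real"
  proof -
    have 0: "AE \<omega> in M. rep (ae_class M (\<lambda>\<omega>. 0 :: real)) \<omega> = 0" by (rule rep_ae_class) simp
    note f2 = rep_ae_class(2)[OF f]
    have "(AE \<omega> in M. rep (ae_class M (\<lambda>\<omega>. 0)) \<omega> < rep (ae_class M f) \<omega>) \<longleftrightarrow> (AE \<omega> in M. 0 < f \<omega>)"
      by (rule eventually_cong, use 0 f2 in eventually_elim) simp_all
    then show ?thesis
      by (simp add: L0_pos_def L0_less_def L0_zero_one ae_class_in_L0[OF f])
  qed
  have "ae_class M (\<lambda>\<omega>. 1) \<in> L0_pos M" by (subst pos_iff) auto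
  then have ne: "?B \<noteq> {}" by blast
  have int: "\<exists>N''\<in>?B. N'' \<subseteq> N \<inter> N'" if NN: "N \<in> ?B" "N' \<in> ?B" for N N'
  proof -
    from NN obtain \<xi> \<eta> where
      N: "N = c_nbhd M E nrm \<xi>" "N' = c_nbhd M E nrm \<eta>" and "\<xi> \<in> L0_pos M" "\<eta> \<in> L0_pos M"
      by blast
    moreover from this obtain f g where f [measurable]: "f \<in> borel_measurable M"
      and g [measurable]: "g \<in> borel_measurable M" and fg: "\<xi> = ae_class M f" "\<eta> = ae_class M g"
      unfolding L0_pos_def by (blast elim!: L0_cases)
    ultimately have pos: "AE \<omega> in M. 0 < f \<omega>" "AE \<omega> in M. 0 < g \<omega>"
      using pos_iff[OF f] pos_iff[OF g] by simp_all
    have m [measurable]: "(\<lambda>\<omega>. min (f \<omega>) (g \<omega>)) \<in> borel_measurable M" by simp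
    have "ae_class M (\<lambda>\<omega>. min (f \<omega>) (g \<omega>)) \<in> L0_pos M"
      unfolding pos_iff[OF m] using pos by eventually_elim simp
    moreover have "c_nbhd M E nrm (ae_class M (\<lambda>\<omega>. min (f \<omega>) (g \<omega>))) \<subseteq> N \<inter> N'"
    proof
      fix x assume x: "x \<in> c_nbhd M E nrm (ae_class M (\<lambda>\<omega>. min (f \<omega>) (g \<omega>)))"
      then have *: "AE \<omega> in M. rep (nrm x) \<omega> < rep (ae_class M (\<lambda>\<omega>. min (f \<omega>) (g \<omega>))) \<omega>"
        by (simp add: c_nbhd_def L0_less_def)
      have "AE \<omega> in M. rep (nrm x) \<omega> < rep \<xi> \<omega>" "AE \<omega> in M. rep (nrm x) \<omega> < rep \<eta> \<omega>"
        using * rep_ae_class(2)[OF m] rep_ae_class(2)[OF f] rep_ae_class(2)[OF g]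
        by (eventually_elim, simp add: fg)+
      with x show "x \<in> N \<inter> N'" by (simp add: N c_nbhd_def L0_less_def)
    qed
    ultimately show ?thesis by blast
  qed
  have "openin (c_topology M E nrm) U \<longleftrightarrow>
    U \<subseteq> carrier E \<and> (\<forall>x\<in>U. \<exists>N\<in>?B. (\<oplus>\<^bsub>E\<^esub>) x ` N \<subseteq> U)"
    unfolding c_topology_def by (rule openin_ti_topology[OF ne]) (rule int)
  moreover have "(\<exists>N\<in>?B. Q N) \<longleftrightarrow> (\<exists>\<epsilon>\<in>L0_pos M. Q (c_nbhd M E nrm \<epsilon>))" for Q by blast
  ultimately show ?thesis by (simp only:)
qed

section \<open>Stability under countable concatenation\<close>

definition countable_partition :: "'w measure \<Rightarrow> (nat \<Rightarrow> 'w set) \<Rightarrow> bool"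
  where "countable_partition M A \<longleftrightarrow>
    range A \<subseteq> sets M \<and> disjoint_family A \<and> (\<Union>n. A n) = space M"

definition is_concat :: "'w measure \<Rightarrow> (('w, 'k::{real_normed_field,euclidean_space}) rv_class, 'e) module \<Rightarrow>
    (nat \<Rightarrow> 'w set) \<Rightarrow> (nat \<Rightarrow> 'e) \<Rightarrow> 'e \<Rightarrow> bool"
  where "is_concat M E A x y \<longleftrightarrow>
    y \<in> carrier E \<and> (\<forall>n. L0_ind M (A n) \<odot>\<^bsub>E\<^esub> y = L0_ind M (A n) \<odot>\<^bsub>E\<^esub> x n)"

text \<open>
  \<open>concatenation M E A x\<close> is the element written \<open>\<Sum>\<^sub>n I(A n) x n\<close>; it is meaningful only if such an element
  exists, as is the case for sequences in a \<open>\<sigma>\<close>-stable set; uniqueness is \<open>is_concat_unique\<close>.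
\<close>

definition concatenation :: "'w measure \<Rightarrow> (('w, 'k::{real_normed_field,euclidean_space}) rv_class, 'e) module \<Rightarrow>
    (nat \<Rightarrow> 'w set) \<Rightarrow> (nat \<Rightarrow> 'e) \<Rightarrow> 'e"
  where "concatenation M E A x = (THE y. is_concat M E A x y)"

definition stable_set :: "'w measure \<Rightarrow> (('w, 'k::{real_normed_field,euclidean_space}) rv_class, 'e) module \<Rightarrow>
    'e set \<Rightarrow> bool"
  where "stable_set M E G \<longleftrightarrow> G \<noteq> {} \<and> G \<subseteq> carrier E \<and>
    (\<forall>x A. range x \<subseteq> G \<and> countable_partition M A \<longrightarrow> (\<exists>y\<in>G. is_concat M E A x y))"

definition stable_map :: "'w measure \<Rightarrow> (('w, 'k::{real_normed_field,euclidean_space}) rv_class, 'e) module \<Rightarrow>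
    (('w, 'k) rv_class, 'f) module \<Rightarrow> 'e set \<Rightarrow> ('e \<Rightarrow> 'f) \<Rightarrow> bool"
  where "stable_map M E\<^sub>1 E\<^sub>2 G T \<longleftrightarrow>
    (\<forall>x A. range x \<subseteq> G \<and> countable_partition M A \<longrightarrow>
      T (concatenation M E\<^sub>1 A x) = concatenation M E\<^sub>2 A (\<lambda>k. T (x k)))"

lemma (in rn_module) is_concat_unique:
  assumes A: "countable_partition M A" and y: "is_concat M E A x y" and z: "is_concat M E A x z"
  shows "y = z"
proof -
  have yE: "y \<in> carrier E" and zE: "z \<in> carrier E" using y z by (auto simp: is_concat_def)
  define d where "d = y \<ominus>\<^bsub>E\<^esub> z"
  have dE: "d \<in> carrier E" using yE zE by (simp add: d_def)
  have Am: "A n \<in> sets M" for n using A by (auto simp: countable_partition_def)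
  have ind: "(indicator (A n) :: 'w \<Rightarrow> 'k) \<in> borel_measurable M" for n using Am by simp
  have ind0: "L0_ind M (A n) \<in> carrier (L0 M :: ('w, 'k) rv_class ring)" for n
    unfolding L0_ind_def by (rule ae_class_in_L0[OF ind])
  obtain f where f [measurable]: "f \<in> borel_measurable M" and nf: "nrm d = ae_class M f"
    using nrm_nonneg[OF dE] by (auto simp: L0_nonneg_def elim: L0_cases)
  have "AE \<omega> in M. \<omega> \<in> A n \<longrightarrow> f \<omega> = 0" for n
  proof -
    let ?I = "L0_ind M (A n) :: ('w, 'k) rv_class"
    let ?h = "\<lambda>\<omega>. norm (rep ?I \<omega>)"
    have I: "rep ?I \<in> borel_measurable M" "AE \<omega> in M. rep ?I \<omega> = indicator (A n) \<omega>"
      unfolding L0_ind_def by (rule rep_ae_class[OF ind])+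
    have h: "?h \<in> borel_measurable M" using I(1) by simp
    have "?I \<odot>\<^bsub>E\<^esub> y = ?I \<odot>\<^bsub>E\<^esub> z" using y z by (simp add: is_concat_def)
    moreover have "?I \<odot>\<^bsub>E\<^esub> (\<ominus>\<^bsub>E\<^esub> z) = \<ominus>\<^bsub>E\<^esub> (?I \<odot>\<^bsub>E\<^esub> z)"
      using E.smult_r_minus[OF ind0 zE] .
    ultimately have "?I \<odot>\<^bsub>E\<^esub> d = \<zero>\<^bsub>E\<^esub>"
      unfolding d_def a_minus_def using yE zE ind0
      by (simp add: E.smult_r_distr E.M.r_neg)
    moreover have "nrm \<zero>\<^bsub>E\<^esub> = \<zero>\<^bsub>L0 M\<^esub>"
    proof -
      obtain g where g: "g \<in> borel_measurable M" "nrm \<zero>\<^bsub>E\<^esub> = ae_class M g"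
        using nrm_nonneg[of "\<zero>\<^bsub>E\<^esub>"] by (auto simp: L0_nonneg_def elim: L0_cases)
      have z: "AE \<omega> in M. rep (\<zero>\<^bsub>L0 M\<^esub> :: ('w, 'k) rv_class) \<omega> = 0"
        "rep (\<zero>\<^bsub>L0 M\<^esub> :: ('w, 'k) rv_class) \<in> borel_measurable M"
        unfolding L0_zero_one by (rule rep_ae_class; simp)+
      have "nrm (\<zero>\<^bsub>L0 M\<^esub> \<odot>\<^bsub>E\<^esub> \<zero>\<^bsub>E\<^esub>) = L0_abs M (\<zero>\<^bsub>L0 M\<^esub> :: ('w, 'k) rv_class) \<otimes>\<^bsub>L0 M\<^esub> nrm \<zero>\<^bsub>E\<^esub>"
        by (rule nrm_smult) simp_all
      moreover have "(\<zero>\<^bsub>L0 M\<^esub> :: ('w, 'k) rv_class) \<odot>\<^bsub>E\<^esub> \<zero>\<^bsub>E\<^esub> = \<zero>\<^bsub>E\<^esub>"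
        by simp
      moreover have "L0_abs M (\<zero>\<^bsub>L0 M\<^esub> :: ('w, 'k) rv_class) = ae_class M (\<lambda>\<omega>. 0)"
        unfolding L0_abs_def using z by (subst ae_class_eq_iff) auto
      ultimately have "nrm \<zero>\<^bsub>E\<^esub> = ae_class M (\<lambda>\<omega>. 0) \<otimes>\<^bsub>L0 M\<^esub> ae_class M g"
        using g(2) by metis
      also have "\<dots> = \<zero>\<^bsub>L0 M\<^esub>" using g(1) by (simp add: L0_ops L0_zero_one)
      finally show ?thesis .
    qed
    ultimately have "L0_abs M ?I \<otimes>\<^bsub>L0 M\<^esub> nrm d = \<zero>\<^bsub>L0 M\<^esub>"
      using nrm_smult[OF ind0 dE] by metis
    then have "ae_class M (\<lambda>\<omega>. ?h \<omega> * f \<omega>) = ae_class M (\<lambda>\<omega>. 0)"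
      by (simp add: nf L0_abs_def L0_ops[OF h f] L0_zero_one)
    then have "AE \<omega> in M. ?h \<omega> * f \<omega> = 0"
      using h f by (subst (asm) ae_class_eq_iff) auto
    with I(2) show ?thesis by eventually_elim auto
  qed
  then have "AE \<omega> in M. \<forall>n. \<omega> \<in> A n \<longrightarrow> f \<omega> = 0" unfolding AE_all_countable by (rule allI)
  then have "AE \<omega> in M. f \<omega> = 0"
    using AE_space
  proof eventually_elim
    case (elim \<omega>)
    then have "\<omega> \<in> (\<Union>n. A n)" using A by (simp add: countable_partition_def)
    with elim show ?case by blast
  qed
  then have "nrm d = \<zero>\<^bsub>L0 M\<^esub>" unfolding nf L0_zero_one by (subst ae_class_eq_iff) auto
  then have "d = \<zero>\<^bsub>E\<^esub>" by (rule nrm_eq_zero[OF dE])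
  then have "\<ominus>\<^bsub>E\<^esub> (\<ominus>\<^bsub>E\<^esub> z) = y"
    using yE zE by (intro E.M.minus_equality) (simp_all add: d_def a_minus_def)
  then show ?thesis using zE by simp
qed

section \<open>Random sequential continuity\<close>

text \<open>
  Sequences are indexed by \<^typ>\<open>nat\<close> starting with 0, so the random indices may take the value 0.
\<close>

definition random_index :: "'w measure \<Rightarrow> (nat \<Rightarrow> 'w \<Rightarrow> nat) \<Rightarrow> bool"
  where "random_index M N \<longleftrightarrow>
    (\<forall>k. N k \<in> measurable M (count_space UNIV)) \<and> (\<forall>k. \<forall>\<omega>\<in>space M. N k \<omega> < N (Suc k) \<omega>)"

definition random_subseq :: "'w measure \<Rightarrow> (('w, 'k::{real_normed_field,euclidean_space}) rv_class, 'e) module \<Rightarrow>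
    (nat \<Rightarrow> 'w \<Rightarrow> nat) \<Rightarrow> (nat \<Rightarrow> 'e) \<Rightarrow> nat \<Rightarrow> 'e"
  where "random_subseq M E N x k = concatenation M E (\<lambda>l. {\<omega> \<in> space M. N k \<omega> = l}) x"

definition random_seq_continuous :: "'w measure \<Rightarrow>
    (('w, 'k::{real_normed_field,euclidean_space}) rv_class, 'e) module \<Rightarrow> ('e \<Rightarrow> ('w, real) rv_class) \<Rightarrow>
    (('w, 'k) rv_class, 'f) module \<Rightarrow> ('f \<Rightarrow> ('w, real) rv_class) \<Rightarrow> 'e set \<Rightarrow> ('e \<Rightarrow> 'f) \<Rightarrow> bool"
  where "random_seq_continuous M E\<^sub>1 nrm\<^sub>1 E\<^sub>2 nrm\<^sub>2 G T \<longleftrightarrow>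
    (\<forall>x\<^sub>0\<in>G. \<forall>x. range x \<subseteq> G \<and> limitin (el_topology M E\<^sub>1 nrm\<^sub>1) x x\<^sub>0 sequentially \<longrightarrow>
      (\<exists>N. random_index M N \<and>
        limitin (el_topology M E\<^sub>2 nrm\<^sub>2) (\<lambda>k. T (random_subseq M E\<^sub>1 N x k)) (T x\<^sub>0) sequentially))"

end

theory Submission
  imports Defs
begin

text \<open>
  A continuous \<open>T\<close> provides random radii \<open>\<delta>\<^sub>k\<close> at \<open>x\<^sub>0\<close> for the tolerances \<open>1/(k+1)\<close>. Convergence in
  probability implies that, for almost every \<open>\<omega>\<close>, \<open>\<parallel>x\<^sub>n - x\<^sub>0\<parallel>(\<omega>) < \<delta>\<^sub>k(\<omega>)\<close> for infinitely many \<open>n\<close>, so the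
  successive first hitting times of these random balls form a random subsequence that \<open>T\<close> maps to a
  sequence converging to \<open>T x\<^sub>0\<close>.

  Conversely, call a set bad at level \<open>n\<close> if on it some \<open>y\<close> within \<open>1/(n+1)\<close> of \<open>x\<^sub>0\<close> has \<open>T y\<close> at distance at
  least \<open>\<epsilon>\<close> from \<open>T x\<^sub>0\<close>. Stability makes bad sets closed under countable unions, so up to null sets there
  is a largest one, \<open>A\<^sub>n\<close>, with a witness \<open>y\<^sub>n\<close>. As \<open>y\<^sub>n\<close> tends to \<open>x\<^sub>0\<close> while every random subsequence of
  \<open>T y\<^sub>n\<close> stays \<open>\<epsilon>\<close>-far from \<open>T x\<^sub>0\<close> on \<open>\<Inter>\<^sub>n A\<^sub>n\<close>, this intersection is null, and the radius \<open>1/(n+1)\<close> with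
  \<open>n\<close> the first index such that \<open>\<omega> \<notin> A\<^sub>n\<close> works for \<open>\<epsilon>\<close>.
\<close>

section \<open>Representatives and random times\<close>

lemma rep_measurable: "\<xi> \<in> carrier (L0 M) \<Longrightarrow> rep \<xi> \<in> borel_measurable M"
  by (auto elim!: L0_cases intro: rep_ae_class)

lemma rep_add:
  assumes "\<xi> \<in> carrier (L0 M)" "\<eta> \<in> carrier (L0 M)"
  shows "AE \<omega> in M. rep (\<xi> \<oplus>\<^bsub>L0 M\<^esub> \<eta>) \<omega> = rep \<xi> \<omega> + rep \<eta> \<omega>"
proof -
  note [measurable] = assms[THEN rep_measurable]
  show ?thesis by (simp add: L0_def) (rule rep_ae_class, measurable)
qed

lemma rep_mult:
  assumes "\<xi> \<in> carrier (L0 M)" "\<eta> \<in> carrier (L0 M)"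
  shows "AE \<omega> in M. rep (\<xi> \<otimes>\<^bsub>L0 M\<^esub> \<eta>) \<omega> = rep \<xi> \<omega> * rep \<eta> \<omega>"
proof -
  note [measurable] = assms[THEN rep_measurable]
  show ?thesis by (simp add: L0_def) (rule rep_ae_class, measurable)
qed

lemma rep_abs:
  assumes "\<xi> \<in> carrier (L0 M)"
  shows "L0_abs M \<xi> \<in> carrier (L0 M)" "AE \<omega> in M. rep (L0_abs M \<xi>) \<omega> = norm (rep \<xi> \<omega>)"
proof -
  note [measurable] = assms[THEN rep_measurable]
  have m: "(\<lambda>\<omega>. norm (rep \<xi> \<omega>)) \<in> borel_measurable M" by measurable
  show "L0_abs M \<xi> \<in> carrier (L0 M)" "AE \<omega> in M. rep (L0_abs M \<xi>) \<omega> = norm (rep \<xi> \<omega>)"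
    unfolding L0_abs_def using m by (auto intro: ae_class_in_L0 rep_ae_class)
qed

lemma L0_less_ae_class:
  assumes "f \<in> borel_measurable M"
  shows "L0_less M \<xi> (ae_class M f) \<longleftrightarrow> (AE \<omega> in M. rep \<xi> \<omega> < f \<omega>)"
  unfolding L0_less_def using rep_ae_class(2)[OF assms]
  by (intro eventually_cong) auto

lemma L0_pos_ae_class:
  assumes f: "f \<in> borel_measurable M"
  shows "ae_class M f \<in> L0_pos M \<longleftrightarrow> (AE \<omega> in M. 0 < f \<omega>)"
proof -
  have "AE \<omega> in M. rep (\<zero>\<^bsub>L0 M\<^esub> :: ('a, real) rv_class) \<omega> = 0"
    unfolding L0_zero_one by (rule rep_ae_class) simp
  then have "(AE \<omega> in M. rep (\<zero>\<^bsub>L0 M\<^esub> :: ('a, real) rv_class) \<omega> < f \<omega>) \<longleftrightarrow> (AE \<omega> in M. 0 < f \<omega>)"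
    by (rule eventually_cong) auto
  then show ?thesis by (simp add: L0_pos_def L0_less_ae_class[OF f] ae_class_in_L0[OF f])
qed

text \<open>Lets the radii of \<open>c_nbhd\<close> range over almost surely positive measurable
  functions instead of classes.\<close>

lemma Bex_L0_pos:
  "(\<exists>\<epsilon>\<in>L0_pos M. P \<epsilon>) \<longleftrightarrow> (\<exists>f\<in>borel_measurable M. (AE \<omega> in M. 0 < f \<omega>) \<and> P (ae_class M f))"
proof -
  have "L0_pos M = ae_class M ` {f \<in> borel_measurable M. AE \<omega> in M. 0 < f \<omega>}"
  proof (intro subset_antisym subsetI)
    fix \<epsilon> assume \<epsilon>: "\<epsilon> \<in> L0_pos M"
    then have "\<epsilon> \<in> carrier (L0 M)" by (simp add: L0_pos_def)
    then obtain f where "f \<in> borel_measurable M" "\<epsilon> = ae_class M f" by (rule L0_cases)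
    with \<epsilon> show "\<epsilon> \<in> ae_class M ` {f \<in> borel_measurable M. AE \<omega> in M. 0 < f \<omega>}"
      using L0_pos_ae_class[of f M] by simp
  qed (use L0_pos_ae_class in auto)
  then show ?thesis by auto
qed

text \<open>Exhaustion: choose a sequence in \<open>C\<close> whose measures have the same supremum
  as those of all members; its union \<open>A\<close> attains this supremum. A member exceeding
  \<open>A\<close> on a non-null set would produce a union of larger measure, where finiteness
  permits the subtraction.\<close>

lemma (in finite_measure) ex_AE_greatest_set:
  assumes C: "C \<subseteq> sets M" "C \<noteq> {}" and UN: "\<And>B :: nat \<Rightarrow> 'a set. range B \<subseteq> C \<Longrightarrow> (\<Union>j. B j) \<in> C"
  shows "\<exists>A\<in>C. \<forall>B\<in>C. AE \<omega> in M. \<omega> \<in> B \<longrightarrow> \<omega> \<in> A"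
proof -
  obtain f :: "nat \<Rightarrow> ennreal" where f: "range f \<subseteq> emeasure M ` C" "Sup (emeasure M ` C) = (SUP i. f i)"
    using ennreal_Sup_countable_SUP[of "emeasure M ` C"] C by auto
  have "\<exists>B. B \<in> C \<and> f i = emeasure M B" for i using f(1) by blast
  then obtain B where B: "\<And>i. B i \<in> C" "\<And>i. f i = emeasure M (B i)" by metis
  define A where "A = (\<Union>j. B j)"
  have A: "A \<in> C" unfolding A_def using B by (intro UN) auto
  have [measurable]: "A \<in> sets M" using A C by auto
  have "AE \<omega> in M. \<omega> \<in> S \<longrightarrow> \<omega> \<in> A" if S: "S \<in> C" for S
  proof -
    have [measurable]: "S \<in> sets M" using S C by auto
    \<comment> \<open>The closure hypothesis speaks of sequences only, so the binary union is
      written as a countable one.\<close>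
    have "(\<Union>j::nat. if j = 0 then S else A) \<in> C" using S A by (intro UN) auto
    moreover have "(\<Union>j::nat. if j = 0 then S else A) = A \<union> S" by (auto split: if_splits)
    ultimately have "emeasure M (A \<union> S) \<le> (SUP i. f i)"
      by (metis SUP_upper f(2))
    also have "\<dots> \<le> emeasure M A"
      unfolding B(2) A_def using B C by (intro SUP_least emeasure_mono sets.countable_UN) auto
    finally have "measure M (A \<union> S) \<le> measure M A"
      by (simp add: emeasure_eq_measure)
    moreover have "measure M (A \<union> S) = measure M A + measure M (S - A)"
      by (subst finite_measure_Union[symmetric]) auto
    ultimately have "measure M (S - A) = 0" using measure_nonneg[of M "S - A"] by linarith
    then have "AE \<omega> in M. \<omega> \<notin> S - A"
      by (intro AE_not_in) (auto simp: null_sets_def emeasure_eq_measure)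
    then show ?thesis by eventually_elim auto
  qed
  with A show ?thesis by blast
qed

text \<open>For each \<open>j\<close>, the part of \<open>A\<close> where \<open>f\<close> is at
  least \<open>1/(j+1)\<close> lies, up to a null set and for all large \<open>n\<close>, in the set
  where \<open>d n\<close> is at least \<open>1/(j+1)\<close>, whose measure tends to 0. Since
  \<open>f\<close> is almost surely positive, these countably many null parts cover \<open>A\<close>
  up to a null set.\<close>

lemma (in finite_measure) AE_not_in_if_tendsto_in_measure:
  fixes d :: "nat \<Rightarrow> 'a \<Rightarrow> real"
  assumes [measurable]: "\<And>n. d n \<in> borel_measurable M" "f \<in> borel_measurable M" "A \<in> sets M"
    and conv: "\<And>\<epsilon>. 0 < \<epsilon> \<Longrightarrow> (\<lambda>n. measure M {\<omega> \<in> space M. \<epsilon> \<le> d n \<omega>}) \<longlonglongrightarrow> 0"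
    and pos: "AE \<omega> in M. 0 < f \<omega>"
    and le: "\<forall>\<^sub>F n in sequentially. AE \<omega> in M. \<omega> \<in> A \<longrightarrow> f \<omega> \<le> d n \<omega>"
  shows "AE \<omega> in M. \<omega> \<notin> A"
proof -
  have "AE \<omega> in M. \<not> (\<omega> \<in> A \<and> inverse (real (Suc j)) \<le> f \<omega>)" for j
  proof -
    let ?S = "{\<omega> \<in> space M. \<omega> \<in> A \<and> inverse (real (Suc j)) \<le> f \<omega>}"
    have "measure M ?S \<le> 0"
    proof (rule tendsto_lowerbound[OF conv])
      show "0 < inverse (real (Suc j))" by simp
      show "\<forall>\<^sub>F n in sequentially. measure M ?S \<le> measure M {\<omega> \<in> space M. inverse (real (Suc j)) \<le> d n \<omega>}"
        using le
      proof eventually_elim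
        case (elim n)
        show ?case
        proof (rule finite_measure_mono_AE)
          show "AE \<omega> in M. \<omega> \<in> ?S \<longrightarrow> \<omega> \<in> {\<omega> \<in> space M. inverse (real (Suc j)) \<le> d n \<omega>}"
            using elim by eventually_elim auto
        qed measurable
      qed
    qed simp
    then have "measure M ?S = 0" using measure_nonneg[of M ?S] by linarith
    then have "AE \<omega> in M. \<omega> \<notin> ?S"
      by (intro AE_not_in) (auto simp: null_sets_def emeasure_eq_measure)
    with AE_space show ?thesis by eventually_elim auto
  qed
  then have "AE \<omega> in M. \<forall>j. \<not> (\<omega> \<in> A \<and> inverse (real (Suc j)) \<le> f \<omega>)"
    unfolding AE_all_countable by (rule allI)
  with pos show ?thesis
  proof eventually_elim
    case (elim \<omega>)
    then show ?case by (metis less_imp_le reals_Archimedean)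
  qed
qed

text \<open>The second disjunct keeps the index well defined and increasing where no hit exists.\<close>

primrec hitting_index :: "(nat \<Rightarrow> nat \<Rightarrow> 'a \<Rightarrow> bool) \<Rightarrow> nat \<Rightarrow> 'a \<Rightarrow> nat"
  where "hitting_index P 0 = (\<lambda>\<omega>. LEAST n. P 0 n \<omega> \<or> (\<forall>m. \<not> P 0 m \<omega>))"
  | "hitting_index P (Suc k) = (\<lambda>\<omega>. LEAST n. hitting_index P k \<omega> < n \<and>
      (P (Suc k) n \<omega> \<or> (\<forall>m>hitting_index P k \<omega>. \<not> P (Suc k) m \<omega>)))"

text \<open>\<open>LEAST\<close> over the naturals preserves measurability, which gives measurable
  indices by induction on \<open>k\<close>. Infinitely many hits at \<omega> exclude the fallback
  disjunct, because one of them lies beyond the preceding index.\<close>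

lemma ex_random_index:
  assumes [measurable]: "\<And>k n. Measurable.pred M (P k n)"
  shows "\<exists>N. random_index M N \<and> (\<forall>k \<omega>. (\<forall>m. \<exists>n>m. P k n \<omega>) \<longrightarrow> P k (N k \<omega>) \<omega>)"
proof (intro exI conjI allI impI)
  have "hitting_index P k \<in> measurable M (count_space UNIV)" for k
  proof (induction k)
    case (Suc k)
    note [measurable] = Suc
    show ?case unfolding hitting_index.simps by measurable
  qed (unfold hitting_index.simps, measurable)
  \<comment> \<open>The \<open>LEAST\<close> has a witness in either case: a hit beyond the
    preceding index or, failing that, the successor of this index.\<close>
  moreover have step: "hitting_index P k \<omega> < hitting_index P (Suc k) \<omega> \<and>
      (P (Suc k) (hitting_index P (Suc k) \<omega>) \<omega> \<or> (\<forall>m>hitting_index P k \<omega>. \<not> P (Suc k) m \<omega>))" for k \<omega>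
    unfolding hitting_index.simps(2) by (rule LeastI_ex) (meson lessI)
  ultimately show "random_index M (hitting_index P)" unfolding random_index_def by blast
  fix k \<omega> assume io: "\<forall>m. \<exists>n>m. P k n \<omega>"
  show "P k (hitting_index P k \<omega>) \<omega>"
  proof (cases k)
    case 0
    have "P 0 (hitting_index P 0 \<omega>) \<omega> \<or> (\<forall>m. \<not> P 0 m \<omega>)"
      unfolding hitting_index.simps(1) by (rule LeastI_ex) blast
    with io 0 show ?thesis by blast
  next
    case (Suc j)
    with io step[of j \<omega>] show ?thesis by blast
  qed
qed

section \<open>The random distance\<close>

context rn_module
begin

text \<open>A random metric as a genuine real function, obtained from one chosen representative. Its
  metric laws therefore hold only almost surely, with a null set depending on the points.\<close>

definition rdist :: "'e \<Rightarrow> 'e \<Rightarrow> 'w \<Rightarrow> real"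
  where "rdist x y = rep (nrm (x \<ominus>\<^bsub>E\<^esub> y))"

lemma nrm_carrier: "x \<in> carrier E \<Longrightarrow> nrm x \<in> carrier (L0 M)"
  using nrm_nonneg by (simp add: L0_nonneg_def)

lemma rdist_measurable [measurable]:
  "x \<in> carrier E \<Longrightarrow> y \<in> carrier E \<Longrightarrow> rdist x y \<in> borel_measurable M"
  unfolding rdist_def by (intro nrm_meas) simp

lemma rep_nrm_smult:
  assumes "\<xi> \<in> carrier (L0 M)" "x \<in> carrier E"
  shows "AE \<omega> in M. rep (nrm (\<xi> \<odot>\<^bsub>E\<^esub> x)) \<omega> = norm (rep \<xi> \<omega>) * rep (nrm x) \<omega>"
  unfolding nrm_smult[OF assms]
  using rep_mult[OF rep_abs(1)[OF assms(1)] nrm_carrier[OF assms(2)]] rep_abs(2)[OF assms(1)]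
  by eventually_elim simp

lemma rep_nrm_zero: "AE \<omega> in M. rep (nrm \<zero>\<^bsub>E\<^esub>) \<omega> = 0"
proof -
  have "AE \<omega> in M. rep (\<zero>\<^bsub>L0 M\<^esub> :: ('w, 'k) rv_class) \<omega> = 0"
    unfolding L0_zero_one by (rule rep_ae_class) simp
  moreover have "\<zero>\<^bsub>L0 M\<^esub> \<odot>\<^bsub>E\<^esub> \<zero>\<^bsub>E\<^esub> = \<zero>\<^bsub>E\<^esub>" by simp
  note rep_nrm_smult[OF E.R.zero_closed E.M.zero_closed, unfolded this]
  ultimately show ?thesis by eventually_elim simp
qed

text \<open>The negative of \<open>x\<close> is its multiple by the class of the constant -1, which
  has modulus 1.\<close>

lemma rep_nrm_minus:
  assumes x: "x \<in> carrier E"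
  shows "AE \<omega> in M. rep (nrm (\<ominus>\<^bsub>E\<^esub> x)) \<omega> = rep (nrm x) \<omega>"
proof -
  let ?m = "ae_class M (\<lambda>_. -1 :: 'k)"
  have m: "?m \<in> carrier (L0 M)" by (rule ae_class_in_L0) simp
  have "\<ominus>\<^bsub>L0 M\<^esub> \<one>\<^bsub>L0 M\<^esub> = ?m"
    by (rule E.R.minus_equality) (simp_all add: m L0_zero_one L0_ops ae_class_in_L0)
  then have "?m \<odot>\<^bsub>E\<^esub> x = \<ominus>\<^bsub>E\<^esub> x"
    using E.smult_l_minus[OF E.R.one_closed x] x by simp
  moreover have "AE \<omega> in M. rep ?m \<omega> = -1" by (rule rep_ae_class) simp
  ultimately show ?thesis using rep_nrm_smult[OF m x] by auto
qed

lemma rdist_refl: "x \<in> carrier E \<Longrightarrow> AE \<omega> in M. rdist x x \<omega> = 0"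
  unfolding rdist_def using rep_nrm_zero by (simp add: a_minus_def E.M.r_neg)

lemma rdist_commute:
  assumes "x \<in> carrier E" "y \<in> carrier E"
  shows "AE \<omega> in M. rdist x y \<omega> = rdist y x \<omega>"
proof -
  have "x \<ominus>\<^bsub>E\<^esub> y = \<ominus>\<^bsub>E\<^esub> (y \<ominus>\<^bsub>E\<^esub> x)"
    using assms by (simp add: a_minus_def E.M.minus_add E.M.a_comm)
  then show ?thesis unfolding rdist_def using rep_nrm_minus assms by simp
qed

lemma rdist_triangle:
  assumes "x \<in> carrier E" "y \<in> carrier E" "z \<in> carrier E"
  shows "AE \<omega> in M. rdist x z \<omega> \<le> rdist x y \<omega> + rdist y z \<omega>"
proof -
  have "(x \<ominus>\<^bsub>E\<^esub> y) \<oplus>\<^bsub>E\<^esub> (y \<ominus>\<^bsub>E\<^esub> z) = x \<ominus>\<^bsub>E\<^esub> z"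
    using assms by (simp add: a_minus_def E.M.a_assoc) (simp add: E.M.a_assoc[symmetric] E.M.l_neg)
  then have "L0_le M (nrm (x \<ominus>\<^bsub>E\<^esub> z)) (nrm (x \<ominus>\<^bsub>E\<^esub> y) \<oplus>\<^bsub>L0 M\<^esub> nrm (y \<ominus>\<^bsub>E\<^esub> z))"
    using nrm_triangle[of "x \<ominus>\<^bsub>E\<^esub> y" "y \<ominus>\<^bsub>E\<^esub> z"] assms by simp
  moreover have "AE \<omega> in M. rep (nrm (x \<ominus>\<^bsub>E\<^esub> y) \<oplus>\<^bsub>L0 M\<^esub> nrm (y \<ominus>\<^bsub>E\<^esub> z)) \<omega> =
      rep (nrm (x \<ominus>\<^bsub>E\<^esub> y)) \<omega> + rep (nrm (y \<ominus>\<^bsub>E\<^esub> z)) \<omega>"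
    using assms by (intro rep_add nrm_carrier) auto
  ultimately show ?thesis
    unfolding L0_le_def rdist_def by eventually_elim simp
qed

text \<open>Rewrites translated neighbourhoods as conditions on the difference
  \<open>y \<ominus> x\<close>, hence on \<open>rdist\<close>.\<close>

lemma translate_subset_iff:
  assumes "x \<in> carrier E" "N \<subseteq> carrier E"
  shows "(\<oplus>\<^bsub>E\<^esub>) x ` N \<subseteq> U \<longleftrightarrow> (\<forall>y\<in>carrier E. y \<ominus>\<^bsub>E\<^esub> x \<in> N \<longrightarrow> y \<in> U)"
proof -
  have 1: "x \<oplus>\<^bsub>E\<^esub> n \<ominus>\<^bsub>E\<^esub> x = n" if "n \<in> carrier E" for n
    using that assms(1) by (simp add: a_minus_def E.M.a_comm[of x] E.M.a_assoc E.M.r_neg)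
  have 2: "x \<oplus>\<^bsub>E\<^esub> (y \<ominus>\<^bsub>E\<^esub> x) = y" if "y \<in> carrier E" for y
    using that assms(1) by (simp add: a_minus_def E.M.a_comm[of x] E.M.a_assoc E.M.l_neg)
  show ?thesis
  proof
    show "(\<oplus>\<^bsub>E\<^esub>) x ` N \<subseteq> U \<Longrightarrow> \<forall>y\<in>carrier E. y \<ominus>\<^bsub>E\<^esub> x \<in> N \<longrightarrow> y \<in> U"
      using 2 by (metis image_subset_iff)
    show "\<forall>y\<in>carrier E. y \<ominus>\<^bsub>E\<^esub> x \<in> N \<longrightarrow> y \<in> U \<Longrightarrow> (\<oplus>\<^bsub>E\<^esub>) x ` N \<subseteq> U"
      using 1 assms by (auto simp: subset_iff)
  qed
qed

section \<open>Balls of random radius and the locally L0-convex topology\<close>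

definition rball :: "'e \<Rightarrow> ('w \<Rightarrow> real) \<Rightarrow> 'e set"
  where "rball x f = {y \<in> carrier E. AE \<omega> in M. rdist y x \<omega> < f \<omega>}"

lemma openin_c_topology_rball:
  "openin (c_topology M E nrm) U \<longleftrightarrow> U \<subseteq> carrier E \<and>
    (\<forall>x\<in>U. \<exists>f\<in>borel_measurable M. (AE \<omega> in M. 0 < f \<omega>) \<and> rball x f \<subseteq> U)"
proof -
  have eq: "(\<oplus>\<^bsub>E\<^esub>) x ` c_nbhd M E nrm (ae_class M f) \<subseteq> U \<longleftrightarrow> rball x f \<subseteq> U"
    if "f \<in> borel_measurable M" "x \<in> carrier E" for x f
  proof -
    have "c_nbhd M E nrm (ae_class M f) \<subseteq> carrier E" by (auto simp: c_nbhd_def)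
    from translate_subset_iff[OF that(2) this] show ?thesis
      using that by (auto simp: rball_def c_nbhd_def L0_less_ae_class rdist_def)
  qed
  show ?thesis unfolding openin_c_topology Bex_L0_pos
    by (intro conj_cong ball_cong bex_cong refl eq) auto
qed

lemma centre_in_rball: "x \<in> carrier E \<Longrightarrow> AE \<omega> in M. 0 < f \<omega> \<Longrightarrow> x \<in> rball x f"
  unfolding rball_def using rdist_refl[of x] by (auto elim: eventually_elim2)

text \<open>At a point \<open>y\<close> of the ball the slack \<open>f - rdist y x\<close> is almost
  surely positive, so it serves as a radius at \<open>y\<close>; the triangle inequality does the
  rest.\<close>

lemma openin_rball:
  assumes x: "x \<in> carrier E" and f [measurable]: "f \<in> borel_measurable M"
  shows "openin (c_topology M E nrm) (rball x f)"
  unfolding openin_c_topology_rball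
proof (intro conjI ballI)
  show "rball x f \<subseteq> carrier E" by (auto simp: rball_def)
  fix y assume "y \<in> rball x f"
  then have y: "y \<in> carrier E" and yx: "AE \<omega> in M. rdist y x \<omega> < f \<omega>" by (auto simp: rball_def)
  show "\<exists>g\<in>borel_measurable M. (AE \<omega> in M. 0 < g \<omega>) \<and> rball y g \<subseteq> rball x f"
  proof (intro bexI[of _ "\<lambda>\<omega>. f \<omega> - rdist y x \<omega>"] conjI subsetI)
    show "AE \<omega> in M. 0 < f \<omega> - rdist y x \<omega>" using yx by eventually_elim simp
    fix z assume "z \<in> rball y (\<lambda>\<omega>. f \<omega> - rdist y x \<omega>)"
    then have z: "z \<in> carrier E" and zy: "AE \<omega> in M. rdist z y \<omega> < f \<omega> - rdist y x \<omega>"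
      by (auto simp: rball_def)
    from zy rdist_triangle[OF z y x] have "AE \<omega> in M. rdist z x \<omega> < f \<omega>" by eventually_elim simp
    with z show "z \<in> rball x f" by (simp add: rball_def)
  qed (use x y in measurable)
qed

lemma topspace_c_topology: "topspace (c_topology M E nrm) = carrier E"
proof -
  have "openin (c_topology M E nrm) (carrier E)"
    unfolding openin_c_topology_rball
    by (auto simp: rball_def intro!: bexI[of _ "\<lambda>_. 1"])
  moreover have "topspace (c_topology M E nrm) \<subseteq> carrier E"
    unfolding topspace_def openin_c_topology_rball by auto
  ultimately show ?thesis using openin_subset by blast
qed

section \<open>The topology of convergence in probability\<close>

lemma openin_el_topology_rdist:
  "openin (el_topology M E nrm) U \<longleftrightarrow> U \<subseteq> carrier E \<and>
    (\<forall>x\<in>U. \<exists>\<epsilon>>0. \<exists>\<delta>>0. \<forall>y\<in>carrier E. prob {\<omega> \<in> space M. \<epsilon> \<le> rdist y x \<omega>} < \<delta> \<longrightarrow> y \<in> U)"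
  (is "_ \<longleftrightarrow> _ \<and> (\<forall>x\<in>U. \<exists>\<epsilon>>0. \<exists>\<delta>>0. ?Q x \<epsilon> \<delta>)")
proof -
  \<comment> \<open>Passing to complementary events turns a large probability of being close into a
    small probability of being far.\<close>
  have eq: "(\<oplus>\<^bsub>E\<^esub>) x ` el_nbhd M E nrm \<epsilon> \<delta> \<subseteq> U \<longleftrightarrow> ?Q x \<epsilon> \<delta>" if x: "x \<in> carrier E" for x \<epsilon> \<delta>
  proof -
    have "prob {\<omega> \<in> space M. rdist y x \<omega> < \<epsilon>} = 1 - prob {\<omega> \<in> space M. \<epsilon> \<le> rdist y x \<omega>}"
      if y: "y \<in> carrier E" for y
    proof -
      have [measurable]: "rdist y x \<in> borel_measurable M" using x y by measurable
      have "{\<omega> \<in> space M. rdist y x \<omega> < \<epsilon>} = space M - {\<omega> \<in> space M. \<epsilon> \<le> rdist y x \<omega>}" by auto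
      then show ?thesis by (simp add: prob_compl)
    qed
    moreover have "el_nbhd M E nrm \<epsilon> \<delta> \<subseteq> carrier E" by (auto simp: el_nbhd_def)
    ultimately show ?thesis unfolding translate_subset_iff[OF x \<open>el_nbhd M E nrm \<epsilon> \<delta> \<subseteq> carrier E\<close>]
      using x by (intro ball_cong refl) (simp add: el_nbhd_def rdist_def)
  qed
  have "(\<exists>\<epsilon> \<delta>. 0 < \<epsilon> \<and> 0 < \<delta> \<and> \<delta> < 1 \<and> ?Q x \<epsilon> \<delta>) \<longleftrightarrow> (\<exists>\<epsilon>>0. \<exists>\<delta>>0. ?Q x \<epsilon> \<delta>)" for x
  proof
    assume "\<exists>\<epsilon>>0. \<exists>\<delta>>0. ?Q x \<epsilon> \<delta>"
    then obtain \<epsilon> \<delta> :: real where "0 < \<epsilon>" "0 < \<delta>" "?Q x \<epsilon> \<delta>" by blast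
    \<comment> \<open>Shrinking \<delta> preserves \<open>?Q\<close>, and the cap 1/2 restores the
      bound \<delta> < 1 in the definition of the topology.\<close>
    then have "0 < \<epsilon> \<and> 0 < min \<delta> (1/2) \<and> min \<delta> (1/2) < 1 \<and> ?Q x \<epsilon> (min \<delta> (1/2))" by simp
    then show "\<exists>\<epsilon> \<delta>. 0 < \<epsilon> \<and> 0 < \<delta> \<and> \<delta> < 1 \<and> ?Q x \<epsilon> \<delta>" by blast
  qed blast
  with eq show ?thesis unfolding openin_el_topology
    by (intro conj_cong refl ball_cong) (simp add: subset_iff)
qed

lemma topspace_el_topology: "topspace (el_topology M E nrm) = carrier E"
proof -
  have "openin (el_topology M E nrm) (carrier E)"
    unfolding openin_el_topology_rdist by (auto intro: exI[of _ 1])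
  moreover have "topspace (el_topology M E nrm) \<subseteq> carrier E"
    unfolding topspace_def openin_el_topology_rdist by auto
  ultimately show ?thesis using openin_subset by blast
qed

text \<open>Every open set around \<open>x0\<close> contains a basic neighbourhood, which settles
  the backward implication. The basic neighbourhoods are not known to be open, so the forward one
  constructs an open set \<open>U\<close> whose members satisfy the desired estimate.\<close>

lemma limitin_el_topology:
  assumes x: "\<And>n. x n \<in> carrier E" and x0: "x0 \<in> carrier E"
  shows "limitin (el_topology M E nrm) x x0 sequentially \<longleftrightarrow>
    (\<forall>\<epsilon>>0. (\<lambda>n. prob {\<omega> \<in> space M. \<epsilon> \<le> rdist (x n) x0 \<omega>}) \<longlonglongrightarrow> 0)"
proof (intro iffI allI impI)
  fix \<epsilon> :: real assume lim: "limitin (el_topology M E nrm) x x0 sequentially" and \<epsilon>: "0 < \<epsilon>"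
  show "(\<lambda>n. prob {\<omega> \<in> space M. \<epsilon> \<le> rdist (x n) x0 \<omega>}) \<longlonglongrightarrow> 0"
  proof (rule order_tendstoI)
    fix a :: real assume "a < 0"
    then show "\<forall>\<^sub>F n in sequentially. a < prob {\<omega> \<in> space M. \<epsilon> \<le> rdist (x n) x0 \<omega>}"
      by (intro always_eventually allI) (auto intro: less_le_trans)
  next
    fix \<delta> :: real assume \<delta>: "0 < \<delta>"
    \<comment> \<open>The slack in \<open>a < \<epsilon>\<close> and \<open>b < \<delta>\<close> makes this set open.\<close>
    define U where "U = {y \<in> carrier E. \<exists>a b. a < \<epsilon> \<and> b < \<delta> \<and> prob {\<omega> \<in> space M. a \<le> rdist y x0 \<omega>} < b}"
    have "openin (el_topology M E nrm) U"
      unfolding openin_el_topology_rdist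
    proof (intro conjI ballI)
      show "U \<subseteq> carrier E" by (auto simp: U_def)
      fix y assume "y \<in> U"
      then obtain a b where y: "y \<in> carrier E" and ab: "a < \<epsilon>" "b < \<delta>"
        "prob {\<omega> \<in> space M. a \<le> rdist y x0 \<omega>} < b" by (auto simp: U_def)
      \<comment> \<open>Half of each gap is spent on moving from \<open>y\<close> to
        \<open>z\<close>; the other half remains as slack, so \<open>z\<close> belongs to
        \<open>U\<close> through the midpoints \<open>(\<epsilon> + a) / 2\<close> and
        \<open>(\<delta> + b) / 2\<close>.\<close>
      have "z \<in> U" if z: "z \<in> carrier E"
        and zy: "prob {\<omega> \<in> space M. (\<epsilon> - a) / 2 \<le> rdist z y \<omega>} < (\<delta> - b) / 2" for z
      proof -
        have [measurable]: "rdist z y \<in> borel_measurable M" "rdist y x0 \<in> borel_measurable M"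
          "rdist z x0 \<in> borel_measurable M" using x0 y z by measurable
        have "prob {\<omega> \<in> space M. (\<epsilon> + a) / 2 \<le> rdist z x0 \<omega>}
          \<le> prob ({\<omega> \<in> space M. (\<epsilon> - a) / 2 \<le> rdist z y \<omega>} \<union> {\<omega> \<in> space M. a \<le> rdist y x0 \<omega>})"
        proof (rule finite_measure_mono_AE)
          show "AE \<omega> in M. \<omega> \<in> {\<omega> \<in> space M. (\<epsilon> + a) / 2 \<le> rdist z x0 \<omega>} \<longrightarrow>
            \<omega> \<in> {\<omega> \<in> space M. (\<epsilon> - a) / 2 \<le> rdist z y \<omega>} \<union> {\<omega> \<in> space M. a \<le> rdist y x0 \<omega>}"
            using rdist_triangle[OF z y x0] by eventually_elim (auto simp: field_simps)
        qed measurable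
        also have "\<dots> \<le> prob {\<omega> \<in> space M. (\<epsilon> - a) / 2 \<le> rdist z y \<omega>} + prob {\<omega> \<in> space M. a \<le> rdist y x0 \<omega>}"
          by (rule measure_Un_le) measurable
        also have "\<dots> < (\<delta> + b) / 2" using zy ab by (simp add: field_simps)
        finally have "prob {\<omega> \<in> space M. (\<epsilon> + a) / 2 \<le> rdist z x0 \<omega>} < (\<delta> + b) / 2" .
        moreover have "(\<epsilon> + a) / 2 < \<epsilon>" "(\<delta> + b) / 2 < \<delta>" using ab by auto
        ultimately show ?thesis using z unfolding U_def by blast
      qed
      moreover have "0 < (\<epsilon> - a) / 2" "0 < (\<delta> - b) / 2" using ab by auto
      ultimately show "\<exists>\<epsilon>>0. \<exists>\<delta>>0. \<forall>z\<in>carrier E. prob {\<omega> \<in> space M. \<epsilon> \<le> rdist z y \<omega>} < \<delta> \<longrightarrow> z \<in> U"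
        by blast
    qed
    moreover have "x0 \<in> U"
    proof -
      have [measurable]: "rdist x0 x0 \<in> borel_measurable M" using x0 by measurable
      have "AE \<omega> in M. \<omega> \<notin> {\<omega> \<in> space M. \<epsilon> / 2 \<le> rdist x0 x0 \<omega>}"
        using rdist_refl[OF x0] by eventually_elim (use \<epsilon> in auto)
      then have "prob {\<omega> \<in> space M. \<epsilon> / 2 \<le> rdist x0 x0 \<omega>} = 0"
        by (subst prob_eq_0) auto
      then have "\<epsilon> / 2 < \<epsilon> \<and> \<delta> / 2 < \<delta> \<and> prob {\<omega> \<in> space M. \<epsilon> / 2 \<le> rdist x0 x0 \<omega>} < \<delta> / 2"
        using \<epsilon> \<delta> by simp
      with x0 show ?thesis unfolding U_def by blast
    qed
    ultimately have "\<forall>\<^sub>F n in sequentially. x n \<in> U" using lim by (auto simp: limitin_def)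
    then show "\<forall>\<^sub>F n in sequentially. prob {\<omega> \<in> space M. \<epsilon> \<le> rdist (x n) x0 \<omega>} < \<delta>"
    proof eventually_elim
      case (elim n)
      then obtain a b where ab: "a < \<epsilon>" "b < \<delta>" "prob {\<omega> \<in> space M. a \<le> rdist (x n) x0 \<omega>} < b"
        by (auto simp: U_def)
      have [measurable]: "rdist (x n) x0 \<in> borel_measurable M" using x x0 by measurable
      have "prob {\<omega> \<in> space M. \<epsilon> \<le> rdist (x n) x0 \<omega>} \<le> prob {\<omega> \<in> space M. a \<le> rdist (x n) x0 \<omega>}"
        using ab by (intro finite_measure_mono) auto
      with ab show ?case by linarith
    qed
  qed
next
  assume conv: "\<forall>\<epsilon>>0. (\<lambda>n. prob {\<omega> \<in> space M. \<epsilon> \<le> rdist (x n) x0 \<omega>}) \<longlonglongrightarrow> 0"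
  show "limitin (el_topology M E nrm) x x0 sequentially"
    unfolding limitin_def topspace_el_topology
  proof (intro conjI allI impI)
    fix U assume "openin (el_topology M E nrm) U \<and> x0 \<in> U"
    then obtain \<epsilon> \<delta> :: real where "\<epsilon> > 0" "\<delta> > 0"
      and U: "\<And>y. y \<in> carrier E \<Longrightarrow> prob {\<omega> \<in> space M. \<epsilon> \<le> rdist y x0 \<omega>} < \<delta> \<Longrightarrow> y \<in> U"
      unfolding openin_el_topology_rdist by metis
    with conv have "\<forall>\<^sub>F n in sequentially. prob {\<omega> \<in> space M. \<epsilon> \<le> rdist (x n) x0 \<omega>} < \<delta>"
      by (intro order_tendstoD(2)[of _ 0]) auto
    then show "\<forall>\<^sub>F n in sequentially. x n \<in> U" by eventually_elim (use U x in auto)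
  qed (rule x0)
qed

text \<open>The indicator of \<open>A n\<close> annihilates \<open>y \<ominus> x n\<close>, so the
  distance between \<open>y\<close> and \<open>x n\<close> vanishes on \<open>A n\<close>. Two
  triangle inequalities then equate their distances to \<open>z\<close> there.\<close>

lemma is_concat_rdist:
  assumes A: "countable_partition M A" and x: "\<And>n. x n \<in> carrier E"
    and y: "is_concat M E A x y" and z: "z \<in> carrier E"
  shows "AE \<omega> in M. \<forall>n. \<omega> \<in> A n \<longrightarrow> rdist y z \<omega> = rdist (x n) z \<omega>"
  unfolding AE_all_countable
proof
  fix n
  have yE: "y \<in> carrier E" using y by (simp add: is_concat_def)
  let ?I = "L0_ind M (A n) :: ('w, 'k) rv_class"
  have "(indicator (A n) :: 'w \<Rightarrow> 'k) \<in> borel_measurable M"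
    using A by (auto simp: countable_partition_def)
  then have I: "?I \<in> carrier (L0 M)" "AE \<omega> in M. rep ?I \<omega> = indicator (A n) \<omega>"
    unfolding L0_ind_def by (auto intro: ae_class_in_L0 rep_ae_class)
  have "?I \<odot>\<^bsub>E\<^esub> y = ?I \<odot>\<^bsub>E\<^esub> x n" using y by (simp add: is_concat_def)
  then have "?I \<odot>\<^bsub>E\<^esub> (y \<ominus>\<^bsub>E\<^esub> x n) = \<zero>\<^bsub>E\<^esub>"
    using yE x[of n] I(1) by (simp add: a_minus_def E.smult_r_distr E.smult_r_minus E.M.r_neg)
  with rep_nrm_smult[OF I(1), of "y \<ominus>\<^bsub>E\<^esub> x n"] yE x[of n]
  have "AE \<omega> in M. rep (nrm \<zero>\<^bsub>E\<^esub>) \<omega> = norm (rep ?I \<omega>) * rdist y (x n) \<omega>"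
    by (simp add: rdist_def)
  with I(2) rep_nrm_zero have 0: "AE \<omega> in M. \<omega> \<in> A n \<longrightarrow> rdist y (x n) \<omega> = 0"
    by eventually_elim auto
  from 0 rdist_commute[OF yE x[of n]] rdist_triangle[OF yE x[of n] z] rdist_triangle[OF x[of n] yE z]
  show "AE \<omega> in M. \<omega> \<in> A n \<longrightarrow> rdist y z \<omega> = rdist (x n) z \<omega>"
    by eventually_elim auto
qed

text \<open>Stability gives existence and \<open>is_concat_unique\<close> gives uniqueness, so the
  description operator selects the element of \<open>G\<close>.\<close>

lemma concatenation_stable_set:
  assumes "stable_set M E G" "countable_partition M A" "range x \<subseteq> G"
  shows "concatenation M E A x \<in> G" "is_concat M E A x (concatenation M E A x)"
proof -
  obtain y where y: "y \<in> G" "is_concat M E A x y" using assms unfolding stable_set_def by blast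
  then have "concatenation M E A x = y"
    unfolding concatenation_def using is_concat_unique[OF assms(2)] by blast
  with y show "concatenation M E A x \<in> G" "is_concat M E A x (concatenation M E A x)" by auto
qed

lemma concatenation_rdist:
  assumes G: "stable_set M E G" "countable_partition M A" "range x \<subseteq> G" and z: "z \<in> G"
  shows "AE \<omega> in M. \<forall>n. \<omega> \<in> A n \<longrightarrow> rdist (concatenation M E A x) z \<omega> = rdist (x n) z \<omega>"
proof -
  have "G \<subseteq> carrier E" using G(1) by (simp add: stable_set_def)
  with G(3) z show ?thesis
    by (intro is_concat_rdist[OF G(2) _ concatenation_stable_set(2)[OF G]]) auto
qed

end

section \<open>Stable mappings\<close>

locale stable_mapping = prob_space M + E1: rn_module M E\<^sub>1 nrm\<^sub>1 + E2: rn_module M E\<^sub>2 nrm\<^sub>2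
  for M :: "'w measure"
    and E\<^sub>1 :: "(('w, 'k::{real_normed_field,euclidean_space}) rv_class, 'e) module"
    and E\<^sub>2 :: "(('w, 'k) rv_class, 'f) module"
    and nrm\<^sub>1 nrm\<^sub>2 +
  fixes G\<^sub>1 :: "'e set" and G\<^sub>2 :: "'f set" and T :: "'e \<Rightarrow> 'f"
  assumes stable: "stable_set M E\<^sub>1 G\<^sub>1" "stable_set M E\<^sub>2 G\<^sub>2"
    and T_funcset: "T \<in> G\<^sub>1 \<rightarrow> G\<^sub>2" and T_stable: "stable_map M E\<^sub>1 E\<^sub>2 G\<^sub>1 T"
begin

lemma in_carrier [simp, intro]: "x \<in> G\<^sub>1 \<Longrightarrow> x \<in> carrier E\<^sub>1" "x \<in> G\<^sub>1 \<Longrightarrow> T x \<in> carrier E\<^sub>2"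
  using stable T_funcset by (auto simp: stable_set_def)

text \<open>Stability moves \<open>T\<close> inside the concatenation, and distances to a
  concatenation are computed piecewise.\<close>

lemma T_concatenation_rdist:
  assumes A: "countable_partition M A" and x: "range x \<subseteq> G\<^sub>1" and z: "z \<in> G\<^sub>1"
  shows "AE \<omega> in M. \<forall>n. \<omega> \<in> A n \<longrightarrow>
    E2.rdist (T (concatenation M E\<^sub>1 A x)) (T z) \<omega> = E2.rdist (T (x n)) (T z) \<omega>"
proof -
  have "range (\<lambda>k. T (x k)) \<subseteq> G\<^sub>2" using x T_funcset by auto
  moreover have "T (concatenation M E\<^sub>1 A x) = concatenation M E\<^sub>2 A (\<lambda>k. T (x k))"
    using T_stable A x by (auto simp: stable_map_def)
  ultimately show ?thesis
    using E2.concatenation_rdist[OF stable(2) A, of "\<lambda>k. T (x k)" "T z"] z T_funcset by auto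
qed

text \<open>The \<epsilon>-\<delta> criterion with random radii; it holds because random balls are
  open and every open set contains one of positive radius around each of its points.\<close>

lemma continuous_map_c_topology_iff:
  "continuous_map (subtopology (c_topology M E\<^sub>1 nrm\<^sub>1) G\<^sub>1) (subtopology (c_topology M E\<^sub>2 nrm\<^sub>2) G\<^sub>2) T \<longleftrightarrow>
    (\<forall>x\<in>G\<^sub>1. \<forall>f\<in>borel_measurable M. (AE \<omega> in M. 0 < f \<omega>) \<longrightarrow>
      (\<exists>g\<in>borel_measurable M. (AE \<omega> in M. 0 < g \<omega>) \<and> T ` (E1.rball x g \<inter> G\<^sub>1) \<subseteq> E2.rball (T x) f))"
  (is "?cont \<longleftrightarrow> ?balls")
proof
  have top: "topspace (subtopology (c_topology M E\<^sub>1 nrm\<^sub>1) G\<^sub>1) = G\<^sub>1"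
    unfolding topspace_subtopology E1.topspace_c_topology by auto
  have top2: "topspace (subtopology (c_topology M E\<^sub>2 nrm\<^sub>2) G\<^sub>2) = G\<^sub>2"
    unfolding topspace_subtopology E2.topspace_c_topology using stable(2) by (auto simp: stable_set_def)
  {
    assume cont: ?cont
    show ?balls
    proof (intro ballI impI)
      fix x and f :: "'w \<Rightarrow> real"
      assume x: "x \<in> G\<^sub>1" and f: "f \<in> borel_measurable M" "AE \<omega> in M. 0 < f \<omega>"
      have "openin (subtopology (c_topology M E\<^sub>2 nrm\<^sub>2) G\<^sub>2) (E2.rball (T x) f \<inter> G\<^sub>2)"
        unfolding openin_subtopology using x f(1) E2.openin_rball[of "T x" f] by blast
      with cont have "openin (subtopology (c_topology M E\<^sub>1 nrm\<^sub>1) G\<^sub>1) {y \<in> G\<^sub>1. T y \<in> E2.rball (T x) f \<inter> G\<^sub>2}"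
        unfolding continuous_map top by blast
      then obtain U where U: "openin (c_topology M E\<^sub>1 nrm\<^sub>1) U"
        "{y \<in> G\<^sub>1. T y \<in> E2.rball (T x) f \<inter> G\<^sub>2} = U \<inter> G\<^sub>1" by (auto simp: openin_subtopology)
      moreover have "T x \<in> E2.rball (T x) f" using x f by (intro E2.centre_in_rball) auto
      ultimately have "x \<in> U" using x T_funcset by auto
      with U(1) obtain g where "g \<in> borel_measurable M" "AE \<omega> in M. 0 < g \<omega>" "E1.rball x g \<subseteq> U"
        unfolding E1.openin_c_topology_rball by blast
      with U(2) show "\<exists>g\<in>borel_measurable M. (AE \<omega> in M. 0 < g \<omega>) \<and>
          T ` (E1.rball x g \<inter> G\<^sub>1) \<subseteq> E2.rball (T x) f" by blast
    qed
  next
    assume balls: ?balls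
    show ?cont
      unfolding continuous_map top top2
    proof (intro conjI allI impI)
      show "T ` G\<^sub>1 \<subseteq> G\<^sub>2" using T_funcset by auto
      fix V assume "openin (subtopology (c_topology M E\<^sub>2 nrm\<^sub>2) G\<^sub>2) V"
      then obtain W where W: "openin (c_topology M E\<^sub>2 nrm\<^sub>2) W" "V = W \<inter> G\<^sub>2" by (auto simp: openin_subtopology)
      define P where "P = {x \<in> G\<^sub>1. T x \<in> V}"
      \<comment> \<open>The preimage \<open>P\<close> must be the trace of an open set of the whole
        module. All balls centred in \<open>P\<close> whose trace stays in \<open>P\<close> are
        collected; by \<open>openin_rball\<close> each is open for any measurable radius.\<close>
      define U where "U = \<Union>{E1.rball x g | x g. x \<in> P \<and> g \<in> borel_measurable M \<and> E1.rball x g \<inter> G\<^sub>1 \<subseteq> P}"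
      have "openin (c_topology M E\<^sub>1 nrm\<^sub>1) U"
        unfolding U_def by (rule openin_Union) (auto simp: P_def intro: E1.openin_rball)
      moreover have "U \<inter> G\<^sub>1 = P"
      proof
        show "U \<inter> G\<^sub>1 \<subseteq> P" by (auto simp: U_def)
        show "P \<subseteq> U \<inter> G\<^sub>1"
        proof
          fix x assume x: "x \<in> P"
          then have "x \<in> G\<^sub>1" "T x \<in> W" using W by (auto simp: P_def)
          with W(1) obtain f where f: "f \<in> borel_measurable M" "AE \<omega> in M. 0 < f \<omega>" "E2.rball (T x) f \<subseteq> W"
            unfolding E2.openin_c_topology_rball by blast
          with balls \<open>x \<in> G\<^sub>1\<close> obtain g where g: "g \<in> borel_measurable M" "AE \<omega> in M. 0 < g \<omega>"
            "T ` (E1.rball x g \<inter> G\<^sub>1) \<subseteq> E2.rball (T x) f" by blast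
          with f have "E1.rball x g \<inter> G\<^sub>1 \<subseteq> P" using W(2) T_funcset by (auto simp: P_def)
          moreover have "x \<in> E1.rball x g" using \<open>x \<in> G\<^sub>1\<close> g by (intro E1.centre_in_rball) auto
          ultimately show "x \<in> U \<inter> G\<^sub>1" using g x \<open>x \<in> G\<^sub>1\<close> unfolding U_def by blast
        qed
      qed
      ultimately show "openin (subtopology (c_topology M E\<^sub>1 nrm\<^sub>1) G\<^sub>1) {x \<in> G\<^sub>1. T x \<in> V}"
        unfolding P_def openin_subtopology by blast
    qed
  }
qed

section \<open>Random subsequences and gluing along countable families of sets\<close>

lemma countable_partition_random_index:
  assumes "random_index M N"
  shows "countable_partition M (\<lambda>l. {\<omega> \<in> space M. N k \<omega> = l})"
proof -
  have [measurable]: "N k \<in> measurable M (count_space UNIV)" using assms by (simp add: random_index_def)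
  have "{\<omega> \<in> space M. N k \<omega> = l} \<in> sets M" for l by measurable
  then show ?thesis by (auto simp: countable_partition_def disjoint_family_on_def)
qed

text \<open>The pieces of the concatenation are the level sets of \<open>N k\<close>, so distances
  can be computed by substituting the index \<open>N k \<omega>\<close> pointwise.\<close>

lemma random_subseq_rdist:
  assumes N: "random_index M N" and x: "range x \<subseteq> G\<^sub>1" and z: "z \<in> G\<^sub>1"
  shows "random_subseq M E\<^sub>1 N x k \<in> G\<^sub>1"
    and "AE \<omega> in M. E1.rdist (random_subseq M E\<^sub>1 N x k) z \<omega> = E1.rdist (x (N k \<omega>)) z \<omega>"
    and "AE \<omega> in M. E2.rdist (T (random_subseq M E\<^sub>1 N x k)) (T z) \<omega> = E2.rdist (T (x (N k \<omega>))) (T z) \<omega>"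
proof -
  note A = countable_partition_random_index[OF N, of k]
  show "random_subseq M E\<^sub>1 N x k \<in> G\<^sub>1"
    unfolding random_subseq_def by (rule E1.concatenation_stable_set[OF stable(1) A x])
  show "AE \<omega> in M. E1.rdist (random_subseq M E\<^sub>1 N x k) z \<omega> = E1.rdist (x (N k \<omega>)) z \<omega>"
    using E1.concatenation_rdist[OF stable(1) A x z] AE_space
    unfolding random_subseq_def by eventually_elim auto
  show "AE \<omega> in M. E2.rdist (T (random_subseq M E\<^sub>1 N x k)) (T z) \<omega> = E2.rdist (T (x (N k \<omega>))) (T z) \<omega>"
    using T_concatenation_rdist[OF A x z] AE_space
    unfolding random_subseq_def by eventually_elim auto
qed

text \<open>The \<open>B j\<close> may overlap, so they are first made disjoint; \<open>z\<close>
  equals \<open>y j\<close> on the j-th disjoint piece and \<open>x0\<close> off the union. The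
  choice of \<open>x0\<close> keeps \<open>z\<close> close to \<open>x0\<close> everywhere once the
  \<open>y j\<close> are close.\<close>

lemma patching:
  fixes B :: "nat \<Rightarrow> 'w set"
  assumes B: "range B \<subseteq> sets M" and y: "range y \<subseteq> G\<^sub>1" and x0: "x0 \<in> G\<^sub>1"
  shows "\<exists>z\<in>G\<^sub>1. AE \<omega> in M.
    (\<omega> \<in> (\<Union>j. B j) \<longrightarrow> (\<exists>j. \<omega> \<in> B j \<and> E1.rdist z x0 \<omega> = E1.rdist (y j) x0 \<omega> \<and>
      E2.rdist (T z) (T x0) \<omega> = E2.rdist (T (y j)) (T x0) \<omega>)) \<and>
    (\<omega> \<notin> (\<Union>j. B j) \<longrightarrow> E1.rdist z x0 \<omega> = 0)"
proof -
  \<comment> \<open>Index 0 is reserved for the complement of the union, and the disjoint pieces are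
    shifted by one.\<close>
  define A where "A n = (case n of 0 \<Rightarrow> space M - (\<Union>j. B j) | Suc j \<Rightarrow> disjointed B j)" for n
  define x where "x n = (case n of 0 \<Rightarrow> x0 | Suc j \<Rightarrow> y j)" for n
  have sub: "disjointed B j \<subseteq> B j" "B j \<subseteq> space M" for j
    using disjointed_subset[of B j] B sets.sets_into_space[of "B j" M] by auto
  have dj: "disjoint_family (disjointed B)" by (rule disjoint_family_disjointed)
  have A: "countable_partition M A"
    unfolding countable_partition_def
  proof (intro conjI)
    show "range A \<subseteq> sets M"
      using B sets.range_disjointed_sets[OF B] by (auto simp: A_def split: nat.splits)
    show "disjoint_family A"
      unfolding disjoint_family_on_def
    proof (intro ballI impI)
      fix m n :: nat assume "m \<noteq> n"
      then show "A m \<inter> A n = {}"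
        using dj sub(1) by (fastforce simp: A_def disjoint_family_on_def split: nat.splits)
    qed
    have "(\<Union>n. A n) = A 0 \<union> (\<Union>j. A (Suc j))" by (subst UNIV_nat_eq) (simp add: image_image)
    also have "\<dots> = space M" using UN_disjointed_eq[of B] sub(2) by (auto simp: A_def)
    finally show "(\<Union>n. A n) = space M" .
  qed
  have x: "range x \<subseteq> G\<^sub>1" using y x0 by (force simp: x_def split: nat.splits)
  show ?thesis
  proof (rule bexI)
    show "concatenation M E\<^sub>1 A x \<in> G\<^sub>1" by (rule E1.concatenation_stable_set[OF stable(1) A x])
    show "AE \<omega> in M.
      (\<omega> \<in> (\<Union>j. B j) \<longrightarrow> (\<exists>j. \<omega> \<in> B j \<and> E1.rdist (concatenation M E\<^sub>1 A x) x0 \<omega> = E1.rdist (y j) x0 \<omega> \<and>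
        E2.rdist (T (concatenation M E\<^sub>1 A x)) (T x0) \<omega> = E2.rdist (T (y j)) (T x0) \<omega>)) \<and>
      (\<omega> \<notin> (\<Union>j. B j) \<longrightarrow> E1.rdist (concatenation M E\<^sub>1 A x) x0 \<omega> = 0)"
      using E1.concatenation_rdist[OF stable(1) A x x0] T_concatenation_rdist[OF A x x0]
        E1.rdist_refl[OF in_carrier(1)[OF x0]] AE_space
    proof eventually_elim
      case (elim \<omega>)
      show ?case
      proof (intro conjI impI)
        assume "\<omega> \<in> (\<Union>j. B j)"
        then obtain j where "\<omega> \<in> disjointed B j" using UN_disjointed_eq[of B] by blast
        with elim(1)[THEN spec, of "Suc j"] elim(2)[THEN spec, of "Suc j"] sub(1)[of j]
        show "\<exists>j. \<omega> \<in> B j \<and> E1.rdist (concatenation M E\<^sub>1 A x) x0 \<omega> = E1.rdist (y j) x0 \<omega> \<and>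
          E2.rdist (T (concatenation M E\<^sub>1 A x)) (T x0) \<omega> = E2.rdist (T (y j)) (T x0) \<omega>"
          by (auto simp: A_def x_def)
      next
        assume "\<omega> \<notin> (\<Union>j. B j)"
        with elim(1)[THEN spec, of 0] elim(3,4) show "E1.rdist (concatenation M E\<^sub>1 A x) x0 \<omega> = 0"
          by (auto simp: A_def x_def)
      qed
    qed
  qed
qed

section \<open>Random subsequences from first hitting times of random balls\<close>

lemma random_seq_continuous_if_c_continuous:
  assumes cont: "continuous_map (subtopology (c_topology M E\<^sub>1 nrm\<^sub>1) G\<^sub>1) (subtopology (c_topology M E\<^sub>2 nrm\<^sub>2) G\<^sub>2) T"
  shows "random_seq_continuous M E\<^sub>1 nrm\<^sub>1 E\<^sub>2 nrm\<^sub>2 G\<^sub>1 T"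
  unfolding random_seq_continuous_def
proof (intro ballI allI impI)
  fix x0 x assume x0: "x0 \<in> G\<^sub>1"
    and "range x \<subseteq> G\<^sub>1 \<and> limitin (el_topology M E\<^sub>1 nrm\<^sub>1) x x0 sequentially"
  then have x: "range x \<subseteq> G\<^sub>1" and lim: "limitin (el_topology M E\<^sub>1 nrm\<^sub>1) x x0 sequentially" by auto
  then have xn [simp]: "x n \<in> G\<^sub>1" for n by auto
  have conv: "(\<lambda>n. prob {\<omega> \<in> space M. \<epsilon> \<le> E1.rdist (x n) x0 \<omega>}) \<longlonglongrightarrow> 0" if "\<epsilon> > 0" for \<epsilon>
    using lim that x0 by (subst (asm) E1.limitin_el_topology) auto
  \<comment> \<open>The random \<epsilon>-\<delta> criterion is applied to the constant tolerances
    \<open>1/(k+1)\<close>.\<close>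
  have "\<exists>g\<in>borel_measurable M. (AE \<omega> in M. 0 < g \<omega>) \<and>
      T ` (E1.rball x0 g \<inter> G\<^sub>1) \<subseteq> E2.rball (T x0) (\<lambda>_. inverse (real (Suc k)))" for k
    using cont x0 unfolding continuous_map_c_topology_iff by simp
  then obtain g where g [measurable]: "\<And>k. g k \<in> borel_measurable M"
    and g_pos: "\<And>k. AE \<omega> in M. 0 < g k \<omega>"
    and g_ball: "\<And>k. T ` (E1.rball x0 (g k) \<inter> G\<^sub>1) \<subseteq> E2.rball (T x0) (\<lambda>_. inverse (real (Suc k)))" by metis
  have d [measurable]: "E1.rdist (x n) x0 \<in> borel_measurable M" for n using x0 by (intro E1.rdist_measurable) auto
  obtain N where N: "random_index M N"
    and hit: "\<And>k \<omega>. (\<forall>m. \<exists>n>m. E1.rdist (x n) x0 \<omega> < g k \<omega>) \<Longrightarrow> E1.rdist (x (N k \<omega>)) x0 \<omega> < g k \<omega>"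
    using ex_random_index[of "\<lambda>k n \<omega>. E1.rdist (x n) x0 \<omega> < g k \<omega>" M] by auto
  \<comment> \<open>For fixed \<open>m\<close>, on the event that no index beyond \<open>m\<close>
    hits the ball, all later distances dominate the positive function \<open>g k\<close>;
    convergence in probability makes this event null.\<close>
  have io: "AE \<omega> in M. \<forall>m. \<exists>n>m. E1.rdist (x n) x0 \<omega> < g k \<omega>" for k
    unfolding AE_all_countable
  proof
    fix m
    let ?A = "{\<omega> \<in> space M. \<forall>n>m. g k \<omega> \<le> E1.rdist (x n) x0 \<omega>}"
    have "AE \<omega> in M. \<omega> \<notin> ?A"
    proof (rule AE_not_in_if_tendsto_in_measure)
      show "\<forall>\<^sub>F n in sequentially. AE \<omega> in M. \<omega> \<in> ?A \<longrightarrow> g k \<omega> \<le> E1.rdist (x n) x0 \<omega>"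
        using eventually_gt_at_top[of m] by eventually_elim simp
    qed (use g_pos conv in auto)
    with AE_space show "AE \<omega> in M. \<exists>n>m. E1.rdist (x n) x0 \<omega> < g k \<omega>"
      by eventually_elim (auto simp: not_le)
  qed
  \<comment> \<open>Pointwise hits at random times become an almost sure bound for a single element
    of the module, to which the inclusion \<open>g_ball\<close> applies.\<close>
  have "AE \<omega> in M. E1.rdist (random_subseq M E\<^sub>1 N x k) x0 \<omega> < g k \<omega>" for k
    using io[of k] random_subseq_rdist(2)[OF N x x0, of k] by eventually_elim (simp add: hit)
  with random_subseq_rdist(1)[OF N x x0]
  have "random_subseq M E\<^sub>1 N x k \<in> E1.rball x0 (g k) \<inter> G\<^sub>1" for k by (simp add: E1.rball_def)
  with g_ball have "T (random_subseq M E\<^sub>1 N x k) \<in> E2.rball (T x0) (\<lambda>_. inverse (real (Suc k)))" for k by blast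
  then have small: "AE \<omega> in M. E2.rdist (T (random_subseq M E\<^sub>1 N x k)) (T x0) \<omega> < inverse (real (Suc k))" for k
    by (simp add: E2.rball_def)
  \<comment> \<open>As the bound \<open>small\<close> is almost sure, these probabilities are
    exactly 0 from some \<open>k\<close> on.\<close>
  have "(\<lambda>k. prob {\<omega> \<in> space M. \<epsilon> \<le> E2.rdist (T (random_subseq M E\<^sub>1 N x k)) (T x0) \<omega>}) \<longlonglongrightarrow> 0"
    if "\<epsilon> > 0" for \<epsilon>
  proof (rule tendsto_eventually)
    have "\<forall>\<^sub>F k in sequentially. inverse (real (Suc k)) < \<epsilon>"
      using LIMSEQ_inverse_real_of_nat that by (rule order_tendstoD)
    then show "\<forall>\<^sub>F k in sequentially. prob {\<omega> \<in> space M. \<epsilon> \<le> E2.rdist (T (random_subseq M E\<^sub>1 N x k)) (T x0) \<omega>} = 0"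
    proof eventually_elim
      case (elim k)
      have [measurable]: "E2.rdist (T (random_subseq M E\<^sub>1 N x k)) (T x0) \<in> borel_measurable M"
        using random_subseq_rdist(1)[OF N x x0] x0 by (intro E2.rdist_measurable) auto
      show ?case using small[of k] elim
        by (subst prob_eq_0) (auto elim!: eventually_mono)
    qed
  qed
  with N show "\<exists>N. random_index M N \<and>
      limitin (el_topology M E\<^sub>2 nrm\<^sub>2) (\<lambda>k. T (random_subseq M E\<^sub>1 N x k)) (T x0) sequentially"
    using random_subseq_rdist(1)[OF N x x0] x0
    by (intro exI[of _ N] conjI iffD2[OF E2.limitin_el_topology]) auto
qed

section \<open>Greatest bad sets and the random radius of continuity\<close>

lemma c_continuous_if_random_seq_continuous:
  assumes rsc: "random_seq_continuous M E\<^sub>1 nrm\<^sub>1 E\<^sub>2 nrm\<^sub>2 G\<^sub>1 T"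
  shows "continuous_map (subtopology (c_topology M E\<^sub>1 nrm\<^sub>1) G\<^sub>1) (subtopology (c_topology M E\<^sub>2 nrm\<^sub>2) G\<^sub>2) T"
  unfolding continuous_map_c_topology_iff
proof (intro ballI impI)
  fix x0 and f :: "'w \<Rightarrow> real"
  assume x0: "x0 \<in> G\<^sub>1" and f [measurable]: "f \<in> borel_measurable M" and f_pos: "AE \<omega> in M. 0 < f \<omega>"
  note [measurable] = E1.rdist_measurable[OF in_carrier(1) in_carrier(1)[OF x0]]
    E2.rdist_measurable[OF in_carrier(2) in_carrier(2)[OF x0]]
  \<comment> \<open>Closeness to \<open>x0\<close> is demanded on the whole space, not just on
    \<open>A\<close>, so that the witnesses of successive levels converge to \<open>x0\<close>.
    Gluing with \<open>x0\<close> off \<open>A\<close> makes this possible.\<close>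
  define bad where "bad n y A \<longleftrightarrow> y \<in> G\<^sub>1 \<and> (AE \<omega> in M. E1.rdist y x0 \<omega> \<le> inverse (real (Suc n)) \<and>
    (\<omega> \<in> A \<longrightarrow> f \<omega> \<le> E2.rdist (T y) (T x0) \<omega>))" for n y A
  have "\<exists>A\<in>{A \<in> sets M. \<exists>y. bad n y A}. \<forall>B\<in>{A \<in> sets M. \<exists>y. bad n y A}. AE \<omega> in M. \<omega> \<in> B \<longrightarrow> \<omega> \<in> A" for n
  proof (rule ex_AE_greatest_set)
    \<comment> \<open>The empty set is bad with witness \<open>x0\<close>, so the exhaustion has a
      nonempty family to start from.\<close>
    have "bad n x0 {}"
      unfolding bad_def using x0 E1.rdist_refl[OF in_carrier(1)[OF x0]] by (auto elim!: eventually_mono)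
    then show "{A \<in> sets M. \<exists>y. bad n y A} \<noteq> {}" by blast
    fix B :: "nat \<Rightarrow> 'w set" assume "range B \<subseteq> {A \<in> sets M. \<exists>y. bad n y A}"
    then have B: "range B \<subseteq> sets M" and "\<forall>j. \<exists>y. bad n y (B j)" by auto
    then obtain y where y: "\<And>j. bad n (y j) (B j)" by metis
    then have yG: "range y \<subseteq> G\<^sub>1" and "AE \<omega> in M. \<forall>j. E1.rdist (y j) x0 \<omega> \<le> inverse (real (Suc n)) \<and>
        (\<omega> \<in> B j \<longrightarrow> f \<omega> \<le> E2.rdist (T (y j)) (T x0) \<omega>)"
      by (auto simp: bad_def AE_all_countable simp del: AE_conj_iff)
    from patching[OF B yG x0] obtain z where "z \<in> G\<^sub>1" and z: "AE \<omega> in M.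
      (\<omega> \<in> (\<Union>j. B j) \<longrightarrow> (\<exists>j. \<omega> \<in> B j \<and> E1.rdist z x0 \<omega> = E1.rdist (y j) x0 \<omega> \<and>
        E2.rdist (T z) (T x0) \<omega> = E2.rdist (T (y j)) (T x0) \<omega>)) \<and>
      (\<omega> \<notin> (\<Union>j. B j) \<longrightarrow> E1.rdist z x0 \<omega> = 0)" by blast
    have "bad n z (\<Union>j. B j)"
      unfolding bad_def
    proof
      from z \<open>AE \<omega> in M. \<forall>j. _ j \<omega>\<close> show "AE \<omega> in M. E1.rdist z x0 \<omega> \<le> inverse (real (Suc n)) \<and>
        (\<omega> \<in> (\<Union>j. B j) \<longrightarrow> f \<omega> \<le> E2.rdist (T z) (T x0) \<omega>)"
      proof eventually_elim
        case (elim \<omega>)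
        show ?case
        proof (cases "\<omega> \<in> (\<Union>j. B j)")
          case True
          with elim(1) obtain j where j: "\<omega> \<in> B j" "E1.rdist z x0 \<omega> = E1.rdist (y j) x0 \<omega>"
            "E2.rdist (T z) (T x0) \<omega> = E2.rdist (T (y j)) (T x0) \<omega>" by blast
          with elim(2) show ?thesis by metis
        next
          case False
          with elim(1) show ?thesis by simp
        qed
      qed
    qed fact
    with B show "(\<Union>j. B j) \<in> {A \<in> sets M. \<exists>y. bad n y A}" by blast
  qed auto
  then obtain A where A: "\<And>n. A n \<in> {A \<in> sets M. \<exists>y. bad n y A}"
    and greatest: "\<And>n B. B \<in> sets M \<Longrightarrow> \<exists>y. bad n y B \<Longrightarrow> AE \<omega> in M. \<omega> \<in> B \<longrightarrow> \<omega> \<in> A n"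
    by (simp only: Bex_def Ball_def mem_Collect_eq) metis
  have [measurable]: "A n \<in> sets M" for n using A by simp
  from A obtain y where y: "\<And>n. bad n (y n) (A n)" by (simp, metis)
  then have yG [simp]: "y n \<in> G\<^sub>1" for n by (simp add: bad_def)
  have yG': "range y \<subseteq> G\<^sub>1" by auto

  have "limitin (el_topology M E\<^sub>1 nrm\<^sub>1) y x0 sequentially"
  proof (subst E1.limitin_el_topology, goal_cases)
    case 3
    show ?case
    proof (intro allI impI tendsto_eventually)
      fix \<epsilon> :: real assume "0 < \<epsilon>"
      with LIMSEQ_inverse_real_of_nat have "\<forall>\<^sub>F n in sequentially. inverse (real (Suc n)) < \<epsilon>"
        by (rule order_tendstoD)
      then show "\<forall>\<^sub>F n in sequentially. prob {\<omega> \<in> space M. \<epsilon> \<le> E1.rdist (y n) x0 \<omega>} = 0"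
      proof eventually_elim
        case (elim n)
        from y[of n] have "AE \<omega> in M. E1.rdist (y n) x0 \<omega> \<le> inverse (real (Suc n))"
          by (auto simp: bad_def)
        with elim show ?case by (subst prob_eq_0) (auto elim!: eventually_mono)
      qed
    qed
  qed (use x0 in auto)
  with rsc x0 yG' obtain N where N: "random_index M N"
    and lim: "limitin (el_topology M E\<^sub>2 nrm\<^sub>2) (\<lambda>k. T (random_subseq M E\<^sub>1 N y k)) (T x0) sequentially"
    unfolding random_seq_continuous_def by blast
  have sub [simp]: "random_subseq M E\<^sub>1 N y k \<in> G\<^sub>1" for k
    by (rule random_subseq_rdist(1)[OF N yG' x0])
  have "AE \<omega> in M. \<omega> \<notin> (\<Inter>n. A n)"
  proof (rule AE_not_in_if_tendsto_in_measure)
    show "(\<lambda>k. prob {\<omega> \<in> space M. \<epsilon> \<le> E2.rdist (T (random_subseq M E\<^sub>1 N y k)) (T x0) \<omega>}) \<longlonglongrightarrow> 0"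
      if "0 < \<epsilon>" for \<epsilon>
      using lim that x0 by (subst (asm) E2.limitin_el_topology) auto
    \<comment> \<open>One null set must serve all \<open>n\<close> at once, since the index
      \<open>N k \<omega>\<close> to be substituted varies with \<omega>.\<close>
    have "AE \<omega> in M. \<forall>n. \<omega> \<in> A n \<longrightarrow> f \<omega> \<le> E2.rdist (T (y n)) (T x0) \<omega>"
      using y by (auto simp: bad_def AE_all_countable)
    then have "AE \<omega> in M. \<omega> \<in> (\<Inter>n. A n) \<longrightarrow> f \<omega> \<le> E2.rdist (T (random_subseq M E\<^sub>1 N y k)) (T x0) \<omega>" for k
      using random_subseq_rdist(3)[OF N yG' x0, of k] by eventually_elim auto
    then show "\<forall>\<^sub>F k in sequentially. AE \<omega> in M. \<omega> \<in> (\<Inter>n. A n) \<longrightarrow>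
      f \<omega> \<le> E2.rdist (T (random_subseq M E\<^sub>1 N y k)) (T x0) \<omega>" by simp
  qed (use f_pos in auto)
  then have exit: "AE \<omega> in M. \<exists>n. \<omega> \<notin> A n" by simp

  \<comment> \<open>Where \<omega> lies in every \<open>A n\<close> the \<open>LEAST\<close> is
    arbitrary, but \<open>g\<close> is still positive, and by \<open>exit\<close> this happens only
    on a null set.\<close>
  define g where "g \<omega> = inverse (real (Suc (LEAST n. \<omega> \<notin> A n)))" for \<omega>
  have "g \<in> borel_measurable M" unfolding g_def by measurable
  moreover have "AE \<omega> in M. 0 < g \<omega>" by (simp add: g_def)
  moreover have "T ` (E1.rball x0 g \<inter> G\<^sub>1) \<subseteq> E2.rball (T x0) f"
  proof safe
    fix x assume x: "x \<in> G\<^sub>1" and "x \<in> E1.rball x0 g"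
    then have less: "AE \<omega> in M. E1.rdist x x0 \<omega> < g \<omega>" by (simp add: E1.rball_def)
    \<comment> \<open>On \<open>?B n\<close> the point \<open>x\<close> itself violates the
      tolerance at level \<open>n\<close>. It may be far from \<open>x0\<close> elsewhere, so the
      witness \<open>z\<close> below is \<open>x\<close> on \<open>?B n\<close> and at distance 0
      from \<open>x0\<close> outside.\<close>
    let ?B = "\<lambda>n. {\<omega> \<in> space M. E1.rdist x x0 \<omega> \<le> inverse (real (Suc n)) \<and> f \<omega> \<le> E2.rdist (T x) (T x0) \<omega>}"
    have "AE \<omega> in M. \<omega> \<in> ?B n \<longrightarrow> \<omega> \<in> A n" for n
    proof (rule greatest)
      show B: "?B n \<in> sets M" using x by measurable
      \<comment> \<open>Constant sequences specialise \<open>patching\<close> to a single set and a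
        single point.\<close>
      then have "range (\<lambda>_::nat. ?B n) \<subseteq> sets M" "range (\<lambda>_::nat. x) \<subseteq> G\<^sub>1" using x by auto
      from patching[OF this x0] obtain z where "z \<in> G\<^sub>1" and z: "AE \<omega> in M.
        (\<omega> \<in> ?B n \<longrightarrow> E1.rdist z x0 \<omega> = E1.rdist x x0 \<omega> \<and>
          E2.rdist (T z) (T x0) \<omega> = E2.rdist (T x) (T x0) \<omega>) \<and>
        (\<omega> \<notin> ?B n \<longrightarrow> E1.rdist z x0 \<omega> = 0)" by auto
      have "bad n z (?B n)"
        unfolding bad_def
      proof
        show "AE \<omega> in M. E1.rdist z x0 \<omega> \<le> inverse (real (Suc n)) \<and>
            (\<omega> \<in> ?B n \<longrightarrow> f \<omega> \<le> E2.rdist (T z) (T x0) \<omega>)"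
          using z
        proof eventually_elim
          case (elim \<omega>)
          then show ?case by (cases "\<omega> \<in> ?B n") auto
        qed
      qed fact
      then show "\<exists>y. bad n y (?B n)" ..
    qed
    then have "AE \<omega> in M. \<forall>n. \<omega> \<in> ?B n \<longrightarrow> \<omega> \<in> A n" by (simp add: AE_all_countable)
    with less exit AE_space have "AE \<omega> in M. E2.rdist (T x) (T x0) \<omega> < f \<omega>"
    proof eventually_elim
      case (elim \<omega>)
      \<comment> \<open>At the level \<open>n\<close> that defines \<open>g \<omega>\<close>,
        \<omega> escapes \<open>A n\<close> and hence \<open>?B n\<close>. The distance of
        \<open>x\<close> to \<open>x0\<close> is below \<open>1/(n+1)\<close>, so only the second
        condition of \<open>?B n\<close> can fail.\<close>
      define n where "n = (LEAST n. \<omega> \<notin> A n)"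
      have "\<omega> \<notin> A n" unfolding n_def using elim(2) by (rule LeastI_ex)
      with elim have "\<omega> \<notin> ?B n" by blast
      with elim(1,3) show ?case by (auto simp: g_def n_def)
    qed
    with x show "T x \<in> E2.rball (T x0) f" by (simp add: E2.rball_def)
  qed
  ultimately show "\<exists>g\<in>borel_measurable M. (AE \<omega> in M. 0 < g \<omega>) \<and>
      T ` (E1.rball x0 g \<inter> G\<^sub>1) \<subseteq> E2.rball (T x0) f" by blast
qed

text \<open>The deterministic indices \<open>N k \<omega> = k\<close> suffice, because continuous
  maps preserve limits of sequences.\<close>

lemma random_seq_continuous_if_el_continuous:
  assumes cont: "continuous_map (subtopology (el_topology M E\<^sub>1 nrm\<^sub>1) G\<^sub>1) (subtopology (el_topology M E\<^sub>2 nrm\<^sub>2) G\<^sub>2) T"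
  shows "random_seq_continuous M E\<^sub>1 nrm\<^sub>1 E\<^sub>2 nrm\<^sub>2 G\<^sub>1 T"
  unfolding random_seq_continuous_def
proof (intro ballI allI impI exI conjI)
  fix x0 x assume x0: "x0 \<in> G\<^sub>1"
    and *: "range x \<subseteq> G\<^sub>1 \<and> limitin (el_topology M E\<^sub>1 nrm\<^sub>1) x x0 sequentially"
  let ?N = "\<lambda>k (_ :: 'w). k"
  show N: "random_index M ?N" by (simp add: random_index_def)
  have x: "range x \<subseteq> G\<^sub>1" and xn [simp]: "x n \<in> G\<^sub>1" for n using * by auto
  note sub = random_subseq_rdist[OF N x x0]
  have "limitin (subtopology (el_topology M E\<^sub>1 nrm\<^sub>1) G\<^sub>1) x x0 sequentially"
    using * x0 by (auto simp: limitin_subtopology)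
  from continuous_map_limit[OF cont this]
  have "limitin (el_topology M E\<^sub>2 nrm\<^sub>2) (\<lambda>k. T (x k)) (T x0) sequentially"
    by (simp add: limitin_subtopology comp_def)
  \<comment> \<open>The random subsequence with constant indices is compared with \<open>x\<close>
    only through distances of images, which agree almost surely.\<close>
  moreover have "prob {\<omega> \<in> space M. \<epsilon> \<le> E2.rdist (T (random_subseq M E\<^sub>1 ?N x k)) (T x0) \<omega>}
      = prob {\<omega> \<in> space M. \<epsilon> \<le> E2.rdist (T (x k)) (T x0) \<omega>}" for \<epsilon> k
  proof -
    have [measurable]: "E2.rdist (T (random_subseq M E\<^sub>1 ?N x k)) (T x0) \<in> borel_measurable M"
      "E2.rdist (T (x k)) (T x0) \<in> borel_measurable M" using sub(1) x0 by auto
    show ?thesis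
    proof (rule finite_measure_eq_AE)
      show "AE \<omega> in M. \<omega> \<in> {\<omega> \<in> space M. \<epsilon> \<le> E2.rdist (T (random_subseq M E\<^sub>1 ?N x k)) (T x0) \<omega>} \<longleftrightarrow>
          \<omega> \<in> {\<omega> \<in> space M. \<epsilon> \<le> E2.rdist (T (x k)) (T x0) \<omega>}"
        using sub(3)[of k] by eventually_elim auto
    qed measurable
  qed
  ultimately show "limitin (el_topology M E\<^sub>2 nrm\<^sub>2) (\<lambda>k. T (random_subseq M E\<^sub>1 ?N x k)) (T x0) sequentially"
    using sub(1) x0 by (simp add: E2.limitin_el_topology)
qed

end

theorem lemma3p3:
  fixes M :: "'w measure"
    and E\<^sub>1 :: "(('w, 'k::{real_normed_field,euclidean_space}) rv_class, 'e) module"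
    and E\<^sub>2 :: "(('w, 'k) rv_class, 'f) module"
    and nrm\<^sub>1 :: "'e \<Rightarrow> ('w, real) rv_class"
    and nrm\<^sub>2 :: "'f \<Rightarrow> ('w, real) rv_class"
    and G\<^sub>1 :: "'e set" and G\<^sub>2 :: "'f set" and T :: "'e \<Rightarrow> 'f"
  assumes "rn_module M E\<^sub>1 nrm\<^sub>1" and "rn_module M E\<^sub>2 nrm\<^sub>2"
    and "stable_set M E\<^sub>1 G\<^sub>1" and "stable_set M E\<^sub>2 G\<^sub>2"
    and "T \<in> G\<^sub>1 \<rightarrow> G\<^sub>2" and "stable_map M E\<^sub>1 E\<^sub>2 G\<^sub>1 T"
  shows "(random_seq_continuous M E\<^sub>1 nrm\<^sub>1 E\<^sub>2 nrm\<^sub>2 G\<^sub>1 T \<longleftrightarrow>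
      continuous_map (subtopology (c_topology M E\<^sub>1 nrm\<^sub>1) G\<^sub>1) (subtopology (c_topology M E\<^sub>2 nrm\<^sub>2) G\<^sub>2) T)
    \<and> (continuous_map (subtopology (el_topology M E\<^sub>1 nrm\<^sub>1) G\<^sub>1) (subtopology (el_topology M E\<^sub>2 nrm\<^sub>2) G\<^sub>2) T \<longrightarrow>
      continuous_map (subtopology (c_topology M E\<^sub>1 nrm\<^sub>1) G\<^sub>1) (subtopology (c_topology M E\<^sub>2 nrm\<^sub>2) G\<^sub>2) T)"
proof -
  \<comment> \<open>Provides \<open>prob_space_axioms\<close> for the interpretation that
    follows.\<close>
  interpret rn_module M E\<^sub>1 nrm\<^sub>1 by fact
  interpret stable_mapping M E\<^sub>1 E\<^sub>2 nrm\<^sub>1 nrm\<^sub>2 G\<^sub>1 G\<^sub>2 T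
    by (intro stable_mapping.intro stable_mapping_axioms.intro prob_space_axioms assms)
  \<comment> \<open>The last claim passes through random sequential continuity.\<close>
  show ?thesis
    using random_seq_continuous_if_c_continuous c_continuous_if_random_seq_continuous
      random_seq_continuous_if_el_continuous by blast
qed

end
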